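(* There exists a Cayley automatic group $G$ separated from automatic groups but for which the Cayley distance function $h_{\psi,\alpha}$ vanishes for some $\mathrm{REG}$-Cayley polynomial-time computable representation $\psi:L\to G$, $L\subseteq\Sigma^*$, and some mapping $\alpha:\Sigma\to G$.
   Context: Let $G$ be a finitely generated group with a finite generating set $A$, and $S=A\cup A^{-1}$. Cayley automatic: $G$ is Cayley automatic if there are a regular language $L\subseteq\Sigma^*$ over a finite alphabet $\Sigma$ and a bijection $\psi:L\to G$ (a Cayley automatic representation) such that for every $s\in S$ the relation $\{(u,v)\in L\times L\mid\psi(u)s=\psi(v)\}$ is recognized by a two-tape synchronous automaton. A function $f:\Sigma^*\to\Sigma^*$ is polynomial-time computable if it is computed by a deterministic one-tape Turing machine in time $O(p(n))$, where $p$ is a polynomial and $n$ is the length of the input. A $\mathrm{REG}$-Cayley polynomial-time computable representation of $G$ is a bijection $\psi:L\to G$, where $L\subseteq\Sigma^*$ is a regular language over a finite alphabet $\Sigma$, for which there exist polynomial-time computable functions $f_s:\Sigma^*\to\Sigma^*$, $s\in S$, with $f_s(L)\subseteq L$ and $\psi(f_s(w))=\psi(w)s$ for all $w\in L$. Cayley distance function: for a bijection $\psi:L\to G$, $L\subseteq\Sigma^*$, and a mapping $\alpha:\Sigma\to G$ (not necessarily injective), let $\pi_\alpha:L\to G$ be $\pi_\alpha(\sigma_1\dots\sigma_k)=\alpha(\sigma_1)\cdots\alpha(\sigma_k)$, with $\pi_\alpha(\epsilon)=e$. Let $L^{\leqslant n}=\{w\in L\mid|w|\leqslant n\}$ and $N=\min\{n\in\mathbb{N}\mid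 L^{\leqslant n}\neq\varnothing\}$. Then $h_{\psi,\alpha}:[N,+\infty)\to\mathbb{R}^+$ is $$h_{\psi,\alpha}(n)=\max\{d_A(\pi_\alpha(w),\psi(w))\mid w\in L^{\leqslant n}\},$$ where $d_A(g,h)$ is the length of a shortest word over $A\cup A^{-1}$ representing $g^{-1}h$. Here $[N,+\infty)$ is understood as the set of integers $n\geqslant N$ and $\mathbb{R}^+$ contains $0$. The function $h_{\psi,\alpha}$ vanishes if $h_{\psi,\alpha}(n)=0$ for all $n$ in its domain. For nondecreasing functions $h_1:[N_1,+\infty)\to\mathbb{R}^+$ and $h_2:[N_2,+\infty)\to\mathbb{R}^+$, write $h_1\preceq h_2$ if there exist integer constants $K,M>0$ and $N_0\geqslant\max\{N_1,N_2\}$ such that $h_1(n)\leqslant Kh_2(Mn)$ for all $n\geqslant N_0$. A Cayley automatic group $G$ is separated from automatic groups if there exists a nondecreasing unbounded function $f$ such that $f\preceq h_{\psi,\alpha}$ for all Cayley automatic representations $\psi:L\to G$, $L\subseteq\Sigma^*$, and all mappings $\alpha:\Sigma\to G$. *)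

theory Defs
  imports
    "HOL-Algebra.Generated_Groups"
    "HOL-Computational_Algebra.Polynomial"
    "HOL-Library.Landau_Symbols"
begin

section \<open>Regular languages and two-tape synchronous automata\<close>

text \<open>
  Alphabets are finite sets of letters and automata have natural numbers as states; up to
  renaming of states this covers all finite deterministic automata.
\<close>

record 'a dfa =
  dfa_states :: "nat set"
  dfa_start :: nat
  dfa_final :: "nat set"
  dfa_trans :: "nat \<Rightarrow> 'a \<Rightarrow> nat"

definition wf_dfa :: "'a set \<Rightarrow> 'a dfa \<Rightarrow> bool" where
  "wf_dfa \<Sigma> M \<longleftrightarrow>
     finite \<Sigma> \<and> finite (dfa_states M) \<and> dfa_start M \<in> dfa_states M \<and>
     dfa_final M \<subseteq> dfa_states M \<and>
     (\<forall>q\<in>dfa_states M. \<forall>a\<in>\<Sigma>. dfa_trans M q a \<in> dfa_states M)"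

definition dfa_accepts :: "'a dfa \<Rightarrow> 'a list \<Rightarrow> bool" where
  "dfa_accepts M w \<longleftrightarrow> foldl (dfa_trans M) (dfa_start M) w \<in> dfa_final M"

definition regular_language :: "'a set \<Rightarrow> 'a list set \<Rightarrow> bool" where
  "regular_language \<Sigma> L \<longleftrightarrow> (\<exists>M. wf_dfa \<Sigma> M \<and> L = {w \<in> lists \<Sigma>. dfa_accepts M w})"

text \<open>
  A two-tape synchronous automaton reads both tapes letter by letter in parallel; the shorter
  word is padded at its end with the symbol \<^const>\<open>None\<close>.
\<close>

fun convolution :: "'a list \<Rightarrow> 'b list \<Rightarrow> ('a option \<times> 'b option) list" where
  "convolution [] [] = []"
| "convolution (a # u) [] = (Some a, None) # convolution u []"
| "convolution [] (b # v) = (None, Some b) # convolution [] v"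
| "convolution (a # u) (b # v) = (Some a, Some b) # convolution u v"

definition padded_alphabet :: "'a set \<Rightarrow> ('a option \<times> 'a option) set" where
  "padded_alphabet \<Sigma> =
     (insert None (Some ` \<Sigma>) \<times> insert None (Some ` \<Sigma>)) - {(None, None)}"

definition synchronously_recognized :: "'a set \<Rightarrow> ('a list \<times> 'a list) set \<Rightarrow> bool" where
  "synchronously_recognized \<Sigma> R \<longleftrightarrow>
     (\<exists>M. wf_dfa (padded_alphabet \<Sigma>) M \<and>
          R = {(u, v). u \<in> lists \<Sigma> \<and> v \<in> lists \<Sigma> \<and> dfa_accepts M (convolution u v)})"


section \<open>Polynomial-time computable functions\<close>

text \<open>
  Deterministic Turing machines with one tape that is infinite in both directions. States and
  tape symbols are natural numbers, the blank is \<^const>\<open>None\<close> (so it is never a letter of the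
  input alphabet), and the machine halts when no transition is defined.
\<close>

datatype head_move = MoveLeft | Stay | MoveRight

fun head_offset :: "head_move \<Rightarrow> int" where
  "head_offset MoveLeft = -1"
| "head_offset Stay = 0"
| "head_offset MoveRight = 1"

record tm =
  tm_states :: "nat set"
  tm_symbols :: "nat set"
  tm_start :: nat
  tm_trans :: "nat \<Rightarrow> nat option \<Rightarrow> (nat \<times> nat option \<times> head_move) option"

definition wf_tm :: "nat set \<Rightarrow> tm \<Rightarrow> bool" where
  "wf_tm \<Sigma> M \<longleftrightarrow>
     finite (tm_states M) \<and> finite (tm_symbols M) \<and> \<Sigma> \<subseteq> tm_symbols M \<and>
     tm_start M \<in> tm_states M \<and>
     (\<forall>q\<in>tm_states M. \<forall>x\<in>insert None (Some ` tm_symbols M). \<forall>q' y d.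
        tm_trans M q x = Some (q', y, d) \<longrightarrow>
          q' \<in> tm_states M \<and> y \<in> insert None (Some ` tm_symbols M))"

text \<open>A configuration consists of the state, the head position and the tape contents.\<close>

type_synonym tm_config = "nat \<times> int \<times> (int \<Rightarrow> nat option)"

fun tm_next :: "tm \<Rightarrow> tm_config \<Rightarrow> tm_config option" where
  "tm_next M (q, h, t) =
     (case tm_trans M q (t h) of
        None \<Rightarrow> None
      | Some (q', y, d) \<Rightarrow> Some (q', h + head_offset d, t(h := y)))"

definition word_tape :: "int \<Rightarrow> nat list \<Rightarrow> int \<Rightarrow> nat option" where
  "word_tape p w i =
     (if p \<le> i \<and> i < p + int (length w) then Some (w ! nat (i - p)) else None)"

text \<open>
  The machine starts on the leftmost input letter. When it halts, the non-blank part of the tape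
  has to be exactly the output word, located anywhere on the tape.
\<close>

definition tm_outputs :: "tm \<Rightarrow> nat \<Rightarrow> nat list \<Rightarrow> nat list \<Rightarrow> bool" where
  "tm_outputs M k w v \<longleftrightarrow>
     (\<exists>q h p. ((tm_start M, 0, word_tape 0 w), (q, h, word_tape p v))
                  \<in> {(c, c'). tm_next M c = Some c'} ^^ k \<and>
              tm_next M (q, h, word_tape p v) = None)"

definition polytime_computable :: "nat set \<Rightarrow> (nat list \<Rightarrow> nat list) \<Rightarrow> bool" where
  "polytime_computable \<Sigma> f \<longleftrightarrow>
     f \<in> lists \<Sigma> \<rightarrow> lists \<Sigma> \<and>
     (\<exists>M (T :: nat \<Rightarrow> nat) (p :: real poly).
        wf_tm \<Sigma> M \<and>
        (\<lambda>n. real (T n)) \<in> O(\<lambda>n. poly p (real n)) \<and>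
        (\<forall>w\<in>lists \<Sigma>. \<exists>k\<le>T (length w). tm_outputs M k w (f w)))"


section \<open>Words and distances in a group\<close>

definition finite_generating_set :: "('g, 'm) monoid_scheme \<Rightarrow> 'g set \<Rightarrow> bool" where
  "finite_generating_set G A \<longleftrightarrow> finite A \<and> A \<subseteq> carrier G \<and> generate G A = carrier G"

definition symmetrized :: "('g, 'm) monoid_scheme \<Rightarrow> 'g set \<Rightarrow> 'g set" where
  "symmetrized G A = A \<union> m_inv G ` A"

definition word_value :: "('g, 'm) monoid_scheme \<Rightarrow> 'g list \<Rightarrow> 'g" where
  "word_value G gs = foldr (\<lambda>g h. g \<otimes>\<^bsub>G\<^esub> h) gs \<one>\<^bsub>G\<^esub>"

definition word_dist :: "('g, 'm) monoid_scheme \<Rightarrow> 'g set \<Rightarrow> 'g \<Rightarrow> 'g \<Rightarrow> nat" where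
  "word_dist G A g h =
     (LEAST n. \<exists>gs\<in>lists (symmetrized G A).
                 length gs = n \<and> word_value G gs = inv\<^bsub>G\<^esub> g \<otimes>\<^bsub>G\<^esub> h)"


section \<open>Representations of groups\<close>

text \<open>
  Letters are natural numbers; every finite alphabet can be renamed to such an alphabet. Likewise,
  finitely generated groups are countable, so each of them has an isomorphic copy of type
  \<^typ>\<open>nat monoid\<close>.
\<close>

definition cayley_automatic_rep ::
  "('g, 'm) monoid_scheme \<Rightarrow> 'g set \<Rightarrow> nat set \<Rightarrow> nat list set \<Rightarrow> (nat list \<Rightarrow> 'g) \<Rightarrow> bool" where
  "cayley_automatic_rep G A \<Sigma> L \<psi> \<longleftrightarrow>
     finite \<Sigma> \<and> regular_language \<Sigma> L \<and> bij_betw \<psi> L (carrier G) \<and>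
     (\<forall>s\<in>symmetrized G A.
        synchronously_recognized \<Sigma> {(u, v). u \<in> L \<and> v \<in> L \<and> \<psi> u \<otimes>\<^bsub>G\<^esub> s = \<psi> v})"

definition cayley_automatic :: "('g, 'm) monoid_scheme \<Rightarrow> 'g set \<Rightarrow> bool" where
  "cayley_automatic G A \<longleftrightarrow> (\<exists>\<Sigma> L \<psi>. cayley_automatic_rep G A \<Sigma> L \<psi>)"

definition reg_cayley_polytime_rep ::
  "('g, 'm) monoid_scheme \<Rightarrow> 'g set \<Rightarrow> nat set \<Rightarrow> nat list set \<Rightarrow> (nat list \<Rightarrow> 'g) \<Rightarrow> bool" where
  "reg_cayley_polytime_rep G A \<Sigma> L \<psi> \<longleftrightarrow>
     finite \<Sigma> \<and> regular_language \<Sigma> L \<and> bij_betw \<psi> L (carrier G) \<and>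
     (\<exists>f. \<forall>s\<in>symmetrized G A.
        polytime_computable \<Sigma> (f s) \<and>
        f s ` L \<subseteq> L \<and> (\<forall>w\<in>L. \<psi> (f s w) = \<psi> w \<otimes>\<^bsub>G\<^esub> s))"


section \<open>The Cayley distance function\<close>

text \<open>
  A function on \<open>[N, +\<infinity>)\<close> is a function on \<^typ>\<open>nat\<close> together with \<open>N\<close>; its values below \<open>N\<close>
  are never used.
\<close>

definition cayley_distance_start :: "nat list set \<Rightarrow> nat" where
  "cayley_distance_start L = (LEAST n. {w \<in> L. length w \<le> n} \<noteq> {})"

definition cayley_distance ::
  "('g, 'm) monoid_scheme \<Rightarrow> 'g set \<Rightarrow> nat list set \<Rightarrow> (nat list \<Rightarrow> 'g) \<Rightarrow> (nat \<Rightarrow> 'g)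
    \<Rightarrow> nat \<Rightarrow> real" where
  "cayley_distance G A L \<psi> \<alpha> n =
     real (Max {word_dist G A (word_value G (map \<alpha> w)) (\<psi> w) | w. w \<in> L \<and> length w \<le> n})"

definition cayley_distance_vanishes ::
  "('g, 'm) monoid_scheme \<Rightarrow> 'g set \<Rightarrow> nat list set \<Rightarrow> (nat list \<Rightarrow> 'g) \<Rightarrow> (nat \<Rightarrow> 'g)
    \<Rightarrow> bool" where
  "cayley_distance_vanishes G A L \<psi> \<alpha> \<longleftrightarrow>
     (\<forall>n\<ge>cayley_distance_start L. cayley_distance G A L \<psi> \<alpha> n = 0)"

definition asymp_le :: "nat \<Rightarrow> (nat \<Rightarrow> real) \<Rightarrow> nat \<Rightarrow> (nat \<Rightarrow> real) \<Rightarrow> bool" where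
  "asymp_le N1 h1 N2 h2 \<longleftrightarrow>
     (\<exists>K M N0 :: nat. K > 0 \<and> M > 0 \<and> N0 \<ge> max N1 N2 \<and>
        (\<forall>n\<ge>N0. h1 n \<le> real K * h2 (M * n)))"

definition separated_from_automatic :: "('g, 'm) monoid_scheme \<Rightarrow> 'g set \<Rightarrow> bool" where
  "separated_from_automatic G A \<longleftrightarrow>
     (\<exists>(N1 :: nat) (f :: nat \<Rightarrow> real).
        (\<forall>n\<ge>N1. f n \<ge> 0) \<and> mono_on {N1..} f \<and> \<not> bdd_above (f ` {N1..}) \<and>
        (\<forall>\<Sigma> L \<psi> \<alpha>.
           cayley_automatic_rep G A \<Sigma> L \<psi> \<and> \<alpha> \<in> \<Sigma> \<rightarrow> carrier G \<longrightarrow>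
           asymp_le N1 f (cayley_distance_start L) (cayley_distance G A L \<psi> \<alpha>)))"

end

theory Submission
  imports Defs "HOL-Library.Nat_Bijection"
begin

text \<open>
  The group is the discrete Heisenberg group \<open>\<langle>x, y, z | x y = y x z, z central\<rangle>\<close>.

  It is Cayley automatic because multiplication by a fixed element is affine in the coordinates
  \<open>(i, j, k)\<close> of \<open>y\<^sup>j x\<^sup>i z\<^sup>k\<close>: writing the coordinates in parallel in base 3, least significant
  digits first, a synchronous automaton can check such equations
  (\<open>recognizable_ternary_eq\<close>, \<open>cayley_automatic_heisenberg\<close>).

  It is separated from automatic groups because its Dehn function is cubic. If the words of a
  Cayley automatic representation spelled the elements that they represent up to a distance
  \<open>h\<close>, then a loop of length \<open>n\<close> could be filled by \<open>O(n)\<close> strips between the words that represent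
  successive vertices, and each strip could be cut into \<open>O(n)\<close> relators of length \<open>O(h)\<close>. Area is
  measured by a 2-cocycle that defines a central extension of nilpotency class 3: it is at most
  cubic in the length of a word, so the loop has area \<open>O(n\<^sup>2 h\<^sup>3)\<close>
  (\<open>loop_area\<close>). But \<open>[x\<^sup>n, [x\<^sup>n, y\<^sup>n]]\<close> has area \<open>2 n\<^sup>3\<close>, so \<open>h\<close> is at least of the order of the
  cube root of \<open>n\<close> (\<open>heisenberg_distance_bound\<close>).

  The words \<open>y\<^sup>j x\<^sup>i z\<^sup>k\<close>, written in unary, are a regular set of normal forms that spell exactly
      the
  elements that they represent, so their distance function vanishes. Multiplication by \<open>x\<close> changes
  \<open>i\<close> by 1; multiplication by \<open>y\<close> changes \<open>j\<close> by 1 and adds \<open>i\<close> to \<open>k\<close>. A synchronous automaton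
      cannot
  copy a unary number in this way, but a Turing machine does it in quadratic time by carrying the
  letters of \<open>x\<^sup>i\<close> one by one to the end of the word (\<open>polytime_times_x\<close>, \<open>polytime_times_y\<close>).
\<close>

section \<open>Recognising languages and relations by finite folds\<close>

text \<open>
  Membership in a regular language as a predicate on words: this form is closed under conjunction
  and lets the same lemmas serve words and convolutions of pairs of words.
\<close>

definition recognizable :: "'a set \<Rightarrow> ('a list \<Rightarrow> bool) \<Rightarrow> bool" where
  "recognizable \<Sigma> P \<longleftrightarrow> (\<exists>M. wf_dfa \<Sigma> M \<and> (\<forall>w\<in>lists \<Sigma>. dfa_accepts M w \<longleftrightarrow> P w))"

lemma recognizable_fold:
  fixes step :: "'q \<Rightarrow> 'a \<Rightarrow> 'q"
  assumes "finite \<Sigma>" "finite Q" "s \<in> Q"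
    and closed: "\<And>q a. q \<in> Q \<Longrightarrow> a \<in> \<Sigma> \<Longrightarrow> step q a \<in> Q"
    and P: "\<And>w. w \<in> lists \<Sigma> \<Longrightarrow> P w \<longleftrightarrow> foldl step s w \<in> F"
  shows "recognizable \<Sigma> P"
proof -
  obtain e :: "'q \<Rightarrow> nat" where e: "inj_on e Q"
    using finite_imp_inj_to_nat_seg[OF assms(2)] by blast
  define d where "d = the_inv_into Q e"
  have d: "d (e q) = q" if "q \<in> Q" for q
    unfolding d_def using e that by (rule the_inv_into_f_f)
  define M where "M = \<lparr>dfa_states = e ` Q, dfa_start = e s, dfa_final = e ` (Q \<inter> F),
    dfa_trans = \<lambda>n a. e (step (d n) a)\<rparr>"
  have run: "foldl step q w \<in> Q \<and> foldl (dfa_trans M) (e q) w = e (foldl step q w)"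
    if "q \<in> Q" "w \<in> lists \<Sigma>" for q w
    using that by (induction w arbitrary: q) (auto simp: M_def d closed)
  have "wf_dfa \<Sigma> M"
    unfolding wf_dfa_def using assms(1-3) closed by (auto simp: M_def d)
  moreover have "dfa_accepts M w \<longleftrightarrow> P w" if "w \<in> lists \<Sigma>" for w
  proof -
    have "dfa_accepts M w \<longleftrightarrow> e (foldl step s w) \<in> e ` (Q \<inter> F)"
      unfolding dfa_accepts_def using run[OF assms(3) that] by (simp add: M_def)
    also have "\<dots> \<longleftrightarrow> foldl step s w \<in> F"
      using run[OF assms(3) that] e by (auto simp: inj_on_def)
    finally show ?thesis using P[OF that] by simp
  qed
  ultimately show ?thesis unfolding recognizable_def by blast
qed

lemma recognizable_conj:
  assumes "recognizable \<Sigma> P" "recognizable \<Sigma> Q"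
  shows "recognizable \<Sigma> (\<lambda>w. P w \<and> Q w)"
proof -
  obtain M N where M: "wf_dfa \<Sigma> M" "\<forall>w\<in>lists \<Sigma>. dfa_accepts M w \<longleftrightarrow> P w"
    and N: "wf_dfa \<Sigma> N" "\<forall>w\<in>lists \<Sigma>. dfa_accepts N w \<longleftrightarrow> Q w"
    using assms unfolding recognizable_def by blast
  define step where "step = (\<lambda>(p, q) a. (dfa_trans M p a, dfa_trans N q a))"
  have run: "foldl step (p, q) w = (foldl (dfa_trans M) p w, foldl (dfa_trans N) q w)" for p q w
    by (induction w arbitrary: p q) (auto simp: step_def)
  show ?thesis
  proof (rule recognizable_fold[where step = step and s = "(dfa_start M, dfa_start N)"
        and Q = "dfa_states M \<times> dfa_states N" and F = "dfa_final M \<times> dfa_final N"])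
    show "P w \<and> Q w \<longleftrightarrow> foldl step (dfa_start M, dfa_start N) w \<in> dfa_final M \<times> dfa_final N"
      if "w \<in> lists \<Sigma>" for w
      using M(2) N(2) that by (auto simp: run dfa_accepts_def)
  qed (use M(1) N(1) in \<open>auto simp: wf_dfa_def step_def\<close>)
qed

lemma regular_languageI:
  assumes "recognizable \<Sigma> P" "L = {w \<in> lists \<Sigma>. P w}"
  shows "regular_language \<Sigma> L"
  using assms unfolding recognizable_def regular_language_def by blast

lemma convolution_in_lists:
  "u \<in> lists \<Sigma> \<Longrightarrow> v \<in> lists \<Sigma> \<Longrightarrow> convolution u v \<in> lists (padded_alphabet \<Sigma>)"
  by (induction u v rule: convolution.induct) (auto simp: padded_alphabet_def)

lemma finite_padded_alphabet: "finite \<Sigma> \<Longrightarrow> finite (padded_alphabet \<Sigma>)"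
  by (simp add: padded_alphabet_def)

lemma synchronously_recognizedI:
  assumes "recognizable (padded_alphabet \<Sigma>) P"
    and "R = {(u, v). u \<in> lists \<Sigma> \<and> v \<in> lists \<Sigma> \<and> P (convolution u v)}"
  shows "synchronously_recognized \<Sigma> R"
proof -
  obtain M where "wf_dfa (padded_alphabet \<Sigma>) M"
    "\<forall>w\<in>lists (padded_alphabet \<Sigma>). dfa_accepts M w \<longleftrightarrow> P w"
    using assms(1) unfolding recognizable_def by blast
  then show ?thesis
    unfolding synchronously_recognized_def assms(2)
    using convolution_in_lists[of _ \<Sigma>] by (intro exI[of _ M]) blast
qed

fun ternary :: "('a \<Rightarrow> int) \<Rightarrow> 'a list \<Rightarrow> int" where
  "ternary \<phi> [] = 0"
| "ternary \<phi> (c # w) = \<phi> c + 3 * ternary \<phi> w"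

text \<open>
  A linear equation between ternary expansions is checked from the least significant digit on:
  the state is the value that the unread part must have. It is divided by 3 at each step, so it
  stays within fixed bounds.
\<close>

lemma recognizable_ternary_eq:
  assumes "finite \<Sigma>"
  shows "recognizable \<Sigma> (\<lambda>w. ternary \<phi> w = b)"
proof -
  define step where "step = (\<lambda>r c. case r of None \<Rightarrow> None
    | Some r \<Rightarrow> if (3::int) dvd r - \<phi> c then Some ((r - \<phi> c) div 3) else None)"
  define D where "D = (\<Sum>c\<in>\<Sigma>. \<bar>\<phi> c\<bar>)"
  define B where "B = \<bar>b\<bar> + D"
  have D: "\<bar>\<phi> c\<bar> \<le> D" if "c \<in> \<Sigma>" for c
    unfolding D_def using assms that by (intro member_le_sum) auto
  have dead: "foldl step None w = None" for w
    by (induction w) (auto simp: step_def)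
  have run: "foldl step (Some r) w = Some 0 \<longleftrightarrow> ternary \<phi> w = r" for r w
  proof (induction w arbitrary: r)
    case (Cons c w)
    show ?case
    proof (cases "3 dvd r - \<phi> c")
      case True
      then have "foldl step (Some r) (c # w) = Some 0 \<longleftrightarrow> ternary \<phi> w = (r - \<phi> c) div 3"
        using Cons.IH by (simp add: step_def)
      then show ?thesis using True by auto
    next
      case False
      then have "foldl step (Some r) (c # w) = None" using dead by (simp add: step_def)
      moreover have "ternary \<phi> (c # w) \<noteq> r" using False by auto
      ultimately show ?thesis by simp
    qed
  qed auto
  show ?thesis
  proof (rule recognizable_fold[where step = step and s = "Some b" and F = "{Some 0}"
        and Q = "insert None (Some ` {-B..B})"])
    have "0 \<le> D" by (simp add: D_def sum_nonneg)
    then have "b \<in> {-B..B}" unfolding B_def by auto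
    then show "Some b \<in> insert None (Some ` {-B..B})" by blast
    show "step q c \<in> insert None (Some ` {-B..B})"
      if "q \<in> insert None (Some ` {-B..B})" "c \<in> \<Sigma>" for q c
    proof (cases q)
      case (Some r)
      then have "\<bar>r\<bar> \<le> B" using that by auto
      then have "\<bar>(r - \<phi> c) div 3\<bar> \<le> B" using D[OF that(2)] unfolding B_def by linarith
      then have "(r - \<phi> c) div 3 \<in> {-B..B}" by auto
      then show ?thesis using Some by (auto simp: step_def)
    qed (simp add: step_def)
  qed (use assms in \<open>auto simp: run\<close>)
qed

definition padded :: "('a \<Rightarrow> int) \<Rightarrow> 'a option \<Rightarrow> int" where
  "padded \<phi> c = (case c of None \<Rightarrow> 0 | Some c \<Rightarrow> \<phi> c)"

lemma ternary_convolution: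
  "ternary (\<lambda>(c, d). padded \<phi> c + padded \<chi> d) (convolution u v) = ternary \<phi> u + ternary \<chi> v"
  by (induction u v rule: convolution.induct) (auto simp: padded_def)

lemma ternary_diff: "ternary (\<lambda>c. \<phi> c - \<chi> c) w = ternary \<phi> w - ternary \<chi> w"
  by (induction w) auto

lemma ternary_uminus: "ternary (\<lambda>c. - \<phi> c) w = - ternary \<phi> w"
  by (induction w) auto

lemma ternary_scale: "ternary (\<lambda>c. k * \<phi> c) w = k * ternary \<phi> w"
  by (induction w) (auto simp: algebra_simps)

section \<open>The discrete Heisenberg group\<close>

text \<open>
  The triple \<open>(i, j, k)\<close>, coded as a natural number, stands for \<open>y\<^sup>j x\<^sup>i z\<^sup>k\<close>, where \<open>z\<close> is
  central and \<open>x y = y x z\<close>.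
\<close>

definition triple :: "int \<Rightarrow> int \<Rightarrow> int \<Rightarrow> nat" where
  "triple i j k = prod_encode (int_encode i, prod_encode (int_encode j, int_encode k))"

definition xco :: "nat \<Rightarrow> int" where
  "xco g = int_decode (fst (prod_decode g))"

definition yco :: "nat \<Rightarrow> int" where
  "yco g = int_decode (fst (prod_decode (snd (prod_decode g))))"

definition zco :: "nat \<Rightarrow> int" where
  "zco g = int_decode (snd (prod_decode (snd (prod_decode g))))"

lemma coordinates_triple [simp]: "xco (triple i j k) = i" "yco (triple i j k) = j" "zco
    (triple i j k) = k"
  by (auto simp: triple_def xco_def yco_def zco_def)

lemma triple_coordinates [simp]: "triple (xco g) (yco g) (zco g) = g"
  by (simp add: triple_def xco_def yco_def zco_def)

lemma triple_eq_iff: "triple i j k = g \<longleftrightarrow> i = xco g \<and> j = yco g \<and> k = zco g"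
  by auto

lemma triple_inject [simp]: "triple i j k = triple i' j' k' \<longleftrightarrow> i = i' \<and> j = j' \<and> k = k'"
  by (simp add: triple_eq_iff)

lemma element_eq_iff: "g = h \<longleftrightarrow> xco g = xco h \<and> yco g = yco h \<and> zco g = zco h"
  by (metis triple_coordinates)

definition heisenberg :: "nat monoid" where
  "heisenberg = \<lparr>carrier = UNIV,
     monoid.mult = \<lambda>g h. triple (xco g + xco h) (yco g + yco h) (zco g + zco h + xco g * yco h),
     one = triple 0 0 0\<rparr>"

lemma carrier_heisenberg [simp]: "carrier heisenberg = UNIV"
  by (simp add: heisenberg_def)

lemma one_heisenberg: "\<one>\<^bsub>heisenberg\<^esub> = triple 0 0 0"
  by (simp add: heisenberg_def)

lemma mult_triple [simp]:
  "triple i j k \<otimes>\<^bsub>heisenberg\<^esub> triple i' j' k' = triple (i + i') (j + j') (k + k' + i * j')"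
  by (simp add: heisenberg_def)

lemma coordinates_mult:
  "xco (g \<otimes>\<^bsub>heisenberg\<^esub> h) = xco g + xco h"
  "yco (g \<otimes>\<^bsub>heisenberg\<^esub> h) = yco g + yco h"
  "zco (g \<otimes>\<^bsub>heisenberg\<^esub> h) = zco g + zco h + xco g * yco h"
  by (auto simp: heisenberg_def)

lemma coordinates_one:
  "xco \<one>\<^bsub>heisenberg\<^esub> = 0" "yco \<one>\<^bsub>heisenberg\<^esub> = 0" "zco \<one>\<^bsub>heisenberg\<^esub> = 0"
  by (auto simp: heisenberg_def)

lemma group_heisenberg: "group heisenberg"
proof (rule groupI)
  show "\<exists>h\<in>carrier heisenberg. h \<otimes>\<^bsub>heisenberg\<^esub> g = \<one>\<^bsub>heisenberg\<^esub>" for g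
    by (rule bexI[of _ "triple (- xco g) (- yco g) (xco g * yco g - zco g)"])
      (auto simp: element_eq_iff coordinates_mult coordinates_one)
qed (auto simp: element_eq_iff coordinates_mult coordinates_one algebra_simps)

interpretation heisenberg: group heisenberg
  by (rule group_heisenberg)

lemma inv_triple: "inv\<^bsub>heisenberg\<^esub> (triple i j k) = triple (- i) (- j) (i * j - k)"
  by (rule heisenberg.inv_equality) (auto simp: one_heisenberg)

definition xgen :: "int \<Rightarrow> nat" where "xgen e = triple e 0 0"
definition ygen :: "int \<Rightarrow> nat" where "ygen e = triple 0 e 0"

lemma coordinates_gen:
  "xco (xgen e) = e" "yco (xgen e) = 0" "zco (xgen e) = 0"
  "xco (ygen e) = 0" "yco (ygen e) = e" "zco (ygen e) = 0"
  by (auto simp: xgen_def ygen_def)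

definition heisenberg_gens :: "nat set" where
  "heisenberg_gens = {xgen 1, ygen 1}"

lemma symmetrized_heisenberg_gens:
  "symmetrized heisenberg heisenberg_gens = {xgen 1, ygen 1, xgen (-1), ygen (-1)}"
  by (auto simp: symmetrized_def heisenberg_gens_def xgen_def ygen_def inv_triple)

lemma finite_generating_set_heisenberg: "finite_generating_set heisenberg heisenberg_gens"
proof -
  interpret H: subgroup "generate heisenberg heisenberg_gens" heisenberg
    by (rule heisenberg.generate_is_subgroup) simp
  let ?H = "generate heisenberg heisenberg_gens"
  note closed = H.m_closed
  have units: "xgen 1 \<in> ?H" "ygen 1 \<in> ?H"
    by (auto intro: generate.incl simp: heisenberg_gens_def)
  have invs: "xgen (-1) \<in> ?H" "ygen (-1) \<in> ?H"
    using H.m_inv_closed[OF units(1)] H.m_inv_closed[OF units(2)]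
    by (auto simp: xgen_def ygen_def inv_triple)
  have int_induct: "P n" if "P 0" "\<And>n. P n \<Longrightarrow> P (n + 1)" "\<And>n. P n \<Longrightarrow> P (n - 1)"
    for P :: "int \<Rightarrow> bool" and n
    by (rule int_induct[where k = 0]) (use that in auto)
  have x: "xgen i \<in> ?H" for i
  proof (rule int_induct)
    show "xgen 0 \<in> ?H" using H.one_closed by (simp add: xgen_def one_heisenberg)
    show "xgen (i + 1) \<in> ?H" if "xgen i \<in> ?H" for i
      using closed[OF that units(1)] by (simp add: xgen_def)
    show "xgen (i - 1) \<in> ?H" if "xgen i \<in> ?H" for i
      using closed[OF that invs(1)] by (simp add: xgen_def)
  qed
  have y: "ygen i \<in> ?H" for i
  proof (rule int_induct)
    show "ygen 0 \<in> ?H" using H.one_closed by (simp add: ygen_def one_heisenberg)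
    show "ygen (i + 1) \<in> ?H" if "ygen i \<in> ?H" for i
      using closed[OF that units(2)] by (simp add: ygen_def)
    show "ygen (i - 1) \<in> ?H" if "ygen i \<in> ?H" for i
      using closed[OF that invs(2)] by (simp add: ygen_def)
  qed
  have z: "triple 0 0 k \<in> ?H" for k
    using closed[OF closed[OF x[of k] y[of 1]] closed[OF x[of "-k"] y[of "-1"]]]
    by (simp add: xgen_def ygen_def)
  have "g \<in> ?H" for g
  proof -
    have "ygen (yco g) \<otimes>\<^bsub>heisenberg\<^esub> xgen (xco g) \<otimes>\<^bsub>heisenberg\<^esub> triple 0 0 (zco g) \<in> ?H"
      by (intro closed x y z)
    then show ?thesis by (simp add: xgen_def ygen_def)
  qed
  then show ?thesis by (auto simp: finite_generating_set_def heisenberg_gens_def)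
qed

section \<open>A Cayley automatic representation\<close>

text \<open>
  A letter \<open>c < 27\<close> carries the three digits \<open>c div 3\<^sup>r mod 3 - 1 \<in> {-1, 0, 1}\<close>. Every integer has
  a unique expansion in such digits without leading zeros, and no sign has to be stored, so
  addition needs no case distinction. The letter with three zero digits is 13.
\<close>

definition digit :: "nat \<Rightarrow> nat \<Rightarrow> int" where
  "digit r c = int (c div 3 ^ r mod 3) - 1"

definition trimmed :: "nat list \<Rightarrow> bool" where
  "trimmed w \<longleftrightarrow> (w \<noteq> [] \<longrightarrow> last w \<noteq> 13)"

definition balanced_words :: "nat list set" where
  "balanced_words = {w \<in> lists {..<27}. trimmed w}"

definition balanced_elem :: "nat list \<Rightarrow> nat" where
  "balanced_elem w = triple (ternary (digit 0) w) (ternary (digit 1) w) (ternary (digit 2) w)"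

lemma digit_range: "\<bar>digit r c\<bar> \<le> 1"
proof -
  have "c div 3 ^ r mod 3 < 3" by simp
  then show ?thesis unfolding digit_def by linarith
qed

lemma digits_inject:
  assumes "digit 0 c = digit 0 d" "digit 1 c = digit 1 d" "digit 2 c = digit 2 d" "c < 27" "d < 27"
  shows "c = d"
proof -
  have *: "c = c mod 3 + 3 * (c div 3 mod 3) + 9 * (c div 9 mod 3)" if "c < 27" for c :: nat
  proof -
    have "c div 9 = c div 3 div 3" by (simp flip: div_mult2_eq)
    moreover have "c div 9 mod 3 = c div 9" using that by simp
    ultimately show ?thesis
      using mult_div_mod_eq[of 3 c] mult_div_mod_eq[of 3 "c div 3"] by linarith
  qed
  show ?thesis using assms *[of c] *[of d] by (simp add: digit_def)
qed

lemma balanced_division: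
  fixes i :: int
  obtains d q where "i = d + 3 * q" "\<bar>d\<bar> \<le> 1" "\<bar>q\<bar> \<le> \<bar>i\<bar>" "i \<noteq> 0 \<Longrightarrow> \<bar>q\<bar> < \<bar>i\<bar>"
proof -
  define q where "q = (i + 1) div 3"
  have "3 * q \<le> i + 1" "i + 1 < 3 * q + 3" unfolding q_def by linarith+
  then show ?thesis by (intro that[of "i - 3 * q" q]) linarith+
qed

lemma letter_with_digits:
  assumes "\<bar>d0\<bar> \<le> 1" "\<bar>d1\<bar> \<le> 1" "\<bar>d2\<bar> \<le> 1"
  obtains c where "c < 27" "digit 0 c = d0" "digit 1 c = d1" "digit 2 c = d2"
proof -
  define e0 e1 e2 where "e0 = nat (d0 + 1)" and "e1 = nat (d1 + 1)" and "e2 = nat (d2 + 1)"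
  have e: "int e0 = d0 + 1" "int e1 = d1 + 1" "int e2 = d2 + 1" "e0 < 3" "e1 < 3" "e2 < 3"
    unfolding e0_def e1_def e2_def using assms by linarith+
  define c where "c = e0 + 3 * (e1 + 3 * e2)"
  have "c mod 3 = e0" and c3: "c div 3 = e1 + 3 * e2"
    unfolding c_def mod_mult_self2 div_mult_self2[OF zero_neq_numeral[symmetric]] using e
        by simp_all
  moreover have "c div 3 mod 3 = e1" "c div 3 div 3 = e2" unfolding c3 using e by simp_all
  moreover have "c div 9 = c div 3 div 3" by (simp flip: div_mult2_eq)
  ultimately show ?thesis
    using e by (intro that[of c]) (simp_all add: digit_def c_def)
qed

lemma ternary_digit_Cons_eq:
  assumes "digit r c + 3 * a = digit s d + 3 * b"
  shows "digit r c = digit s d" "a = b"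
proof -
  show "a = b" using assms digit_range[of r c] digit_range[of s d] by linarith
  then show "digit r c = digit s d" using assms by simp
qed

lemma balanced_words_Cons:
  "c # w \<in> balanced_words \<longleftrightarrow> c < 27 \<and> w \<in> balanced_words \<and> (w = [] \<longrightarrow> c \<noteq> 13)"
  by (auto simp: balanced_words_def trimmed_def)

lemma balanced_elem_zero:
  assumes "w \<in> balanced_words" "balanced_elem w = triple 0 0 0"
  shows "w = []"
  using assms
proof (induction w)
  case (Cons c w)
  have z: "digit r 13 = 0" if "r \<in> {0, 1, 2}" for r using that by (auto simp: digit_def)
  have "digit r c + 3 * ternary (digit r) w = digit r 13 + 3 * 0" if "r \<in> {0, 1, 2}" for r
    using Cons.prems(2) that z[OF that] by (auto simp: balanced_elem_def)
  then have eq: "digit r c = digit r 13" "ternary (digit r) w = 0" if "r \<in> {0, 1, 2}" for r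
    using ternary_digit_Cons_eq[of r c _ r 13 0] that by blast+
  have "w = []" using Cons eq(2) by (simp add: balanced_words_Cons balanced_elem_def)
  moreover have "c = 13"
    using digits_inject[of c 13] eq(1) Cons.prems(1) by (simp add: balanced_words_Cons)
  ultimately show ?case using Cons.prems(1) by (simp add: balanced_words_Cons)
qed simp

lemma balanced_elem_inj:
  assumes "u \<in> balanced_words" "v \<in> balanced_words" "balanced_elem u = balanced_elem v"
  shows "u = v"
  using assms
proof (induction u arbitrary: v)
  case Nil
  then show ?case using balanced_elem_zero[of v] by (simp add: balanced_elem_def)
next
  case (Cons c u)
  show ?case
  proof (cases v)
    case Nil
    then show ?thesis using balanced_elem_zero[of "c # u"] Cons.prems by
        (simp add: balanced_elem_def)
  next
    case v: (Cons d v')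
    have "digit r c + 3 * ternary (digit r) u = digit r d + 3 * ternary (digit r) v'"
      if "r \<in> {0, 1, 2}" for r
      using Cons.prems(3) that by (auto simp: balanced_elem_def v)
    then have eq: "digit r c = digit r d" "ternary (digit r) u = ternary (digit r) v'"
      if "r \<in> {0, 1, 2}" for r
      using ternary_digit_Cons_eq[of r c _ r d] that by blast+
    have "c = d"
      using digits_inject[of c d] eq(1) Cons.prems by (simp add: v balanced_words_Cons)
    moreover have "u = v'"
      using Cons.IH[of v'] Cons.prems eq(2) by (simp add: v balanced_words_Cons balanced_elem_def)
    ultimately show ?thesis using v by simp
  qed
qed

lemma balanced_elem_surj: "\<exists>w\<in>balanced_words. balanced_elem w = triple i j k"
proof (induction "nat (\<bar>i\<bar> + \<bar>j\<bar> + \<bar>k\<bar>)" arbitrary: i j k rule: less_induct)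
  case less
  show ?case
  proof (cases "i = 0 \<and> j = 0 \<and> k = 0")
    case True
    then show ?thesis
      by (intro bexI[of _ "[]"]) (auto simp: balanced_elem_def balanced_words_def trimmed_def)
  next
    case False
    obtain d0 q0 where 0: "i = d0 + 3 * q0" "\<bar>d0\<bar> \<le> 1" "\<bar>q0\<bar> \<le> \<bar>i\<bar>" "i \<noteq> 0 \<Longrightarrow> \<bar>q0\<bar> < \<bar>i\<bar>"
      using balanced_division[of i] by blast
    obtain d1 q1 where 1: "j = d1 + 3 * q1" "\<bar>d1\<bar> \<le> 1" "\<bar>q1\<bar> \<le> \<bar>j\<bar>" "j \<noteq> 0 \<Longrightarrow> \<bar>q1\<bar> < \<bar>j\<bar>"
      using balanced_division[of j] by blast
    obtain d2 q2 where 2: "k = d2 + 3 * q2" "\<bar>d2\<bar> \<le> 1" "\<bar>q2\<bar> \<le> \<bar>k\<bar>" "k \<noteq> 0 \<Longrightarrow> \<bar>q2\<bar> < \<bar>k\<bar>"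
      using balanced_division[of k] by blast
    have "\<bar>q0\<bar> + \<bar>q1\<bar> + \<bar>q2\<bar> < \<bar>i\<bar> + \<bar>j\<bar> + \<bar>k\<bar>"
      using False 0(3,4) 1(3,4) 2(3,4) by (smt (verit))
    then have "nat (\<bar>q0\<bar> + \<bar>q1\<bar> + \<bar>q2\<bar>) < nat (\<bar>i\<bar> + \<bar>j\<bar> + \<bar>k\<bar>)"
      by (subst nat_less_eq_zless) auto
    from less.hyps[OF this] obtain w
      where w: "w \<in> balanced_words" "balanced_elem w = triple q0 q1 q2" by blast
    obtain c where c27: "c < 27" and dig: "digit 0 c = d0" "digit 1 c = d1" "digit 2 c = d2"
      using letter_with_digits[OF 0(2) 1(2) 2(2)] .
    have val: "balanced_elem (c # w) = triple i j k"
      using w(2) by (simp add: balanced_elem_def dig dig[unfolded One_nat_def] 0(1) 1(1) 2(1))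
    have "c \<noteq> 13" if "w = []"
    proof
      assume "c = 13"
      then have "balanced_elem (c # w) = triple 0 0 0"
        using that by (simp add: balanced_elem_def digit_def)
      then show False using val False by simp
    qed
    then have "c # w \<in> balanced_words" using w(1) c27 by (simp add: balanced_words_Cons)
    then show ?thesis using val by blast
  qed
qed

lemma bij_betw_balanced_elem: "bij_betw balanced_elem balanced_words (carrier heisenberg)"
proof -
  have "g \<in> balanced_elem ` balanced_words" for g
    using balanced_elem_surj[of "xco g" "yco g" "zco g"] by (metis triple_coordinates image_eqI)
  then show ?thesis
    unfolding bij_betw_def inj_on_def using balanced_elem_inj by auto
qed

lemma regular_balanced_words: "regular_language {..<27} balanced_words"
proof (rule regular_languageI)
  show "recognizable {..<27} trimmed"
  proof (rule recognizable_fold[where step = "\<lambda>_ c. c \<noteq> 13" and s = True and Q = UNIV and F =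
      "{True}"])
    show "trimmed w \<longleftrightarrow> foldl (\<lambda>_ c. c \<noteq> 13) True w \<in> {True}" for w
      by (cases w rule: rev_cases) (auto simp: trimmed_def)
  qed auto
qed (simp add: balanced_words_def)

text \<open>
  The two flags remember, for each tape, whether the last letter read before the padding is
  different from the zero letter.
\<close>

lemma recognizable_both_trimmed:
  assumes "finite \<Sigma>"
  shows "\<exists>P. recognizable (padded_alphabet \<Sigma>) P \<and>
    (\<forall>u v. P (convolution u v) \<longleftrightarrow> trimmed u \<and> trimmed v)"
proof -
  define step :: "bool \<times> bool \<Rightarrow> nat option \<times> nat option \<Rightarrow> bool \<times> bool" where
    "step = (\<lambda>(p, q) (c, d). (case c of None \<Rightarrow> p | Some c \<Rightarrow> c \<noteq> 13,
                              case d of None \<Rightarrow> q | Some d \<Rightarrow> d \<noteq> 13))"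
  have run: "foldl step (p, q) (convolution u v) =
      (if u = [] then p else last u \<noteq> 13, if v = [] then q else last v \<noteq> 13)" for p q u v
    by (induction u v arbitrary: p q rule: convolution.induct) (auto simp: step_def)
  have "recognizable (padded_alphabet \<Sigma>) (\<lambda>w. foldl step (True, True) w \<in> {(True, True)})"
    by (rule recognizable_fold[where Q = UNIV and step = step and s = "(True, True)"
          and F = "{(True, True)}"]) (use assms in \<open>auto simp: finite_padded_alphabet\<close>)
  moreover have "foldl step (True, True) (convolution u v) \<in> {(True, True)} \<longleftrightarrow> trimmed u \<and> trimmed v"
    for u v by (auto simp: run trimmed_def)
  ultimately show ?thesis by blast
qed

lemma recognizable_ternary_pair_eq:
  assumes "finite \<Sigma>"
  shows "\<exists>P. recognizable (padded_alphabet \<Sigma>) P \<and>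
    (\<forall>u v. P (convolution u v) \<longleftrightarrow> ternary \<phi> v = ternary \<chi> u + b)"
proof -
  let ?P = "\<lambda>w. ternary (\<lambda>(c, d). padded (\<lambda>c. - \<chi> c) c + padded \<phi> d) w = b"
  have "recognizable (padded_alphabet \<Sigma>) ?P"
    by (intro recognizable_ternary_eq finite_padded_alphabet assms)
  moreover have "?P (convolution u v) \<longleftrightarrow> ternary \<phi> v = ternary \<chi> u + b" for u v
    unfolding ternary_convolution ternary_uminus by auto
  ultimately show ?thesis by blast
qed

text \<open>
  For a fixed right factor the product is affine in the coordinates, and in base 3 affine maps are
  synchronous.
\<close>

lemma cayley_automatic_heisenberg: "cayley_automatic heisenberg A"
proof -
  let ?\<Sigma> = "{..<27::nat}"
  have "synchronously_recognized ?\<Sigma> {(u, v). u \<in> balanced_words \<and> v \<in> balanced_words \<and>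
      balanced_elem u \<otimes>\<^bsub>heisenberg\<^esub> s = balanced_elem v}" for s
  proof -
    obtain P0 where P0: "recognizable (padded_alphabet ?\<Sigma>) P0"
      "\<And>u v. P0 (convolution u v) \<longleftrightarrow> trimmed u \<and> trimmed v"
      using recognizable_both_trimmed[of ?\<Sigma>] by auto
    obtain P1 where P1: "recognizable (padded_alphabet ?\<Sigma>) P1"
      "\<And>u v. P1 (convolution u v) \<longleftrightarrow> ternary (digit 0) v = ternary (digit 0) u + xco s"
      using recognizable_ternary_pair_eq[of ?\<Sigma> "digit 0" "digit 0" "xco s"] by auto
    obtain P2 where P2: "recognizable (padded_alphabet ?\<Sigma>) P2"
      "\<And>u v. P2 (convolution u v) \<longleftrightarrow> ternary (digit 1) v = ternary (digit 1) u + yco s"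
      using recognizable_ternary_pair_eq[of ?\<Sigma> "digit 1" "digit 1" "yco s"] by auto
    obtain P3 where P3: "recognizable (padded_alphabet ?\<Sigma>) P3"
      "\<And>u v. P3 (convolution u v) \<longleftrightarrow>
         ternary (digit 2) v = ternary (\<lambda>c. digit 2 c - (- yco s) * digit 0 c) u + zco s"
      using recognizable_ternary_pair_eq
        [of ?\<Sigma> "digit 2" "\<lambda>c. digit 2 c - (- yco s) * digit 0 c" "zco s"] by auto
    have product: "balanced_elem u \<otimes>\<^bsub>heisenberg\<^esub> s = balanced_elem v \<longleftrightarrow>
        ternary (digit 0) v = ternary (digit 0) u + xco s \<and>
        ternary (digit 1) v = ternary (digit 1) u + yco s \<and>
        ternary (digit 2) v =
          ternary (digit 2) u - (- yco s) * ternary (digit 0) u + zco s" for u v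
      unfolding element_eq_iff[of "_ \<otimes>\<^bsub>heisenberg\<^esub> _"] coordinates_mult
      by (auto simp: balanced_elem_def mult.commute)
    show ?thesis
    proof (rule synchronously_recognizedI)
      show "recognizable (padded_alphabet ?\<Sigma>) (\<lambda>w. P0 w \<and> P1 w \<and> P2 w \<and> P3 w)"
        by (intro recognizable_conj P0 P1 P2 P3)
      show "{(u, v). u \<in> balanced_words \<and> v \<in> balanced_words \<and>
          balanced_elem u \<otimes>\<^bsub>heisenberg\<^esub> s = balanced_elem v} =
        {(u, v). u \<in> lists ?\<Sigma> \<and> v \<in> lists ?\<Sigma> \<and> P0 (convolution u v) \<and>
          P1 (convolution u v) \<and> P2 (convolution u v) \<and> P3 (convolution u v)}"
        unfolding P0 P1 P2 P3 ternary_diff ternary_scale product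
        by (auto simp: balanced_words_def)
    qed
  qed
  then show ?thesis
    unfolding cayley_automatic_def cayley_automatic_rep_def
    using regular_balanced_words bij_betw_balanced_elem by blast
qed

section \<open>Synchronous relations and bounded completions\<close>

lemma convolution_append:
  assumes "length u = length v \<or> (length u < length v \<and> u' = []) \<or> (length v < length u \<and> v' = [])"
  shows "convolution (u @ u') (v @ v') = convolution u v @ convolution u' v'"
  using assms by (induction u v rule: convolution.induct) auto

text \<open>
  After \<open>t\<close> letters only the state of the automaton and the set of exhausted tapes matter for what
  may follow. These data take finitely many values, so one admissible continuation per value
  suffices, and their lengths are bounded.
\<close>

lemma synchronous_completion:
  assumes "synchronously_recognized \<Sigma> R"
  shows "\<exists>C. \<forall>u v t. (u, v) \<in> R \<longrightarrow> (\<exists>u' v'. length u' \<le> C \<and> length v' \<le> C \<and>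
    (length u \<le> t \<longrightarrow> u' = []) \<and> (take t u @ u', take t v @ v') \<in> R)"
proof -
  obtain M where M: "wf_dfa (padded_alphabet \<Sigma>) M"
    and R: "R = {(u, v). u \<in> lists \<Sigma> \<and> v \<in> lists \<Sigma> \<and> dfa_accepts M (convolution u v)}"
    using assms unfolding synchronously_recognized_def by blast
  define good where "good = (\<lambda>(q, a, b) (u, v). (a \<longrightarrow> u = []) \<and> (b \<longrightarrow> v = []) \<and>
    u \<in> lists \<Sigma> \<and> v \<in> lists \<Sigma> \<and> foldl (dfa_trans M) q (convolution u v) \<in> dfa_final M)"
  define pick where "pick = (\<lambda>x. SOME p. good x p)"
  define X where "X = dfa_states M \<times> (UNIV :: bool set) \<times> (UNIV :: bool set)"
  define C where "C = (\<Sum>x\<in>X. length (fst (pick x)) + length (snd (pick x)))"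
  have finX: "finite X" using M by (simp add: X_def wf_dfa_def)
  have run: "foldl (dfa_trans M) q w \<in> dfa_states M"
    if "q \<in> dfa_states M" "w \<in> lists (padded_alphabet \<Sigma>)" for q w
    using that M by (induction w arbitrary: q) (auto simp: wf_dfa_def)
  show ?thesis
  proof (intro exI[of _ C] allI impI)
    fix u v t
    assume uv: "(u, v) \<in> R"
    have uvl: "u \<in> lists \<Sigma>" "v \<in> lists \<Sigma>" using uv by (auto simp: R)
    have tl: "take t u \<in> lists \<Sigma>" "take t v \<in> lists \<Sigma>" "drop t u \<in> lists \<Sigma>" "drop t v \<in> lists \<Sigma>"
      using uvl by (auto dest: in_set_takeD in_set_dropD)
    define q where "q = foldl (dfa_trans M) (dfa_start M) (convolution (take t u) (take t v))"
    define x where "x = (q, length u \<le> t, length v \<le> t)"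
    have split: "convolution (take t u @ u') (take t v @ v')
        = convolution (take t u) (take t v) @ convolution u' v'"
      if "length u \<le> t \<longrightarrow> u' = []" "length v \<le> t \<longrightarrow> v' = []" for u' v'
      by (rule convolution_append) (use that in auto)
    have "q \<in> dfa_states M"
      unfolding q_def using M tl by (intro run convolution_in_lists) (auto simp: wf_dfa_def)
    then have x: "x \<in> X" by (simp add: x_def X_def)
    have "good x (drop t u, drop t v)"
      using uv split[of "drop t u" "drop t v"] tl
      by (auto simp: good_def x_def q_def R dfa_accepts_def)
    then have good: "good x (pick x)" unfolding pick_def by (rule someI)
    obtain u' v' where p: "pick x = (u', v')" by fastforce
    have "length u' + length v' \<le> C"
      unfolding C_def using member_le_sum[OF x _ finX, of "\<lambda>x. length (fst (pick x)) + length (snd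
          (pick x))"]
      by (simp add: p)
    moreover have "(take t u @ u', take t v @ v') \<in> R"
    proof -
      have g: "length u \<le> t \<longrightarrow> u' = []" "length v \<le> t \<longrightarrow> v' = []" "u' \<in> lists \<Sigma>" "v' \<in> lists \<Sigma>"
        "foldl (dfa_trans M) q (convolution u' v') \<in> dfa_final M"
        using good[unfolded p] unfolding good_def x_def by simp_all
      then have "dfa_accepts M (convolution (take t u @ u') (take t v @ v'))"
        unfolding dfa_accepts_def split[OF g(1,2)] q_def by simp
      then show ?thesis using g(3,4) tl(1,2) unfolding R by simp
    qed
    moreover have "length u \<le> t \<longrightarrow> u' = []"
      using good[unfolded p] unfolding good_def x_def by simp
    ultimately show "\<exists>u' v'. length u' \<le> C \<and> length v' \<le> C \<and> (length u \<le> t \<longrightarrow> u' = []) \<and>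
        (take t u @ u', take t v @ v') \<in> R"
      by (metis add_leD1 add_leD2)
  qed
qed

section \<open>Words in the generators\<close>

definition near :: "('g, 'm) monoid_scheme \<Rightarrow> 'g set \<Rightarrow> nat \<Rightarrow> 'g \<Rightarrow> 'g \<Rightarrow> bool" where
  "near G A n g h \<longleftrightarrow> (\<exists>w\<in>lists (symmetrized G A). length w \<le> n \<and> g \<otimes>\<^bsub>G\<^esub> word_value G w = h)"

context group
begin

lemma word_value_simps [simp]:
  "word_value G [] = \<one>" "word_value G (g # w) = g \<otimes> word_value G w"
  by (simp_all add: word_value_def)

lemma word_value_closed [simp]: "w \<in> lists (carrier G) \<Longrightarrow> word_value G w \<in> carrier G"
  by (induction w) auto

lemma word_value_append [simp]:
  "u \<in> lists (carrier G) \<Longrightarrow> v \<in> lists (carrier G) \<Longrightarrow>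
   word_value G (u @ v) = word_value G u \<otimes> word_value G v"
  by (induction u) (auto simp: m_assoc)

lemma symmetrized_closed: "A \<subseteq> carrier G \<Longrightarrow> symmetrized G A \<subseteq> carrier G"
  by (auto simp: symmetrized_def)

lemma word_value_inverse:
  assumes "A \<subseteq> carrier G" "w \<in> lists (symmetrized G A)"
  shows "\<exists>w'\<in>lists (symmetrized G A). length w' = length w \<and> word_value G w' = inv (word_value G w)"
  using assms(2)
proof (induction w rule: list.induct)
  case (Cons s w)
  then obtain w' where w': "w' \<in> lists (symmetrized G A)" "length w' = length w"
    "word_value G w' = inv (word_value G w)" by auto
  have sub: "symmetrized G A \<subseteq> carrier G" using assms(1) by (rule symmetrized_closed)
  have "s \<in> symmetrized G A" using Cons.prems by simp
  then have s: "s \<in> carrier G" "inv s \<in> symmetrized G A"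
    using assms(1) by (auto simp: symmetrized_def)
  have mem: "w' \<in> lists (carrier G)" "w \<in> lists (carrier G)"
    using w'(1) Cons.prems sub by auto
  show ?case
    using w' s mem sub by (intro bexI[of _ "w' @ [inv s]"]) (auto simp: inv_mult_group)
qed auto

lemma ex_word_value:
  assumes "finite_generating_set G A" "g \<in> carrier G"
  shows "\<exists>w\<in>lists (symmetrized G A). word_value G w = g"
proof -
  have A: "A \<subseteq> carrier G" and g: "g \<in> generate G A"
    using assms by (auto simp: finite_generating_set_def)
  have sub: "symmetrized G A \<subseteq> carrier G" using A by (rule symmetrized_closed)
  show ?thesis
    using g
  proof (induction g rule: generate.induct)
    case one
    show ?case by (intro bexI[of _ "[]"]) auto
  next
    case (incl h)
    then show ?case using A by (intro bexI[of _ "[h]"]) (auto simp: symmetrized_def)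
  next
    case (inv h)
    then show ?case using A by (intro bexI[of _ "[inv h]"]) (auto simp: symmetrized_def)
  next
    case (eng g h)
    then obtain u v where "u \<in> lists (symmetrized G A)" "v \<in> lists (symmetrized G A)"
      "word_value G u = g" "word_value G v = h" by blast
    moreover from this have "u \<in> lists (carrier G)" "v \<in> lists (carrier G)"
      using lists_mono[OF sub] by blast+
    ultimately show ?case by (intro bexI[of _ "u @ v"]) simp_all
  qed
qed

lemma word_dist_self: "g \<in> carrier G \<Longrightarrow> word_dist G A g g = 0"
  unfolding word_dist_def by (rule Least_eq_0) (intro bexI[of _ "[]"], auto)

lemma shortest_word:
  assumes "finite_generating_set G A" "g \<in> carrier G" "h \<in> carrier G"
  obtains w where "w \<in> lists (symmetrized G A)" "length w = word_dist G A g h"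
    "g \<otimes> word_value G w = h"
proof -
  have "\<exists>n. \<exists>w\<in>lists (symmetrized G A). length w = n \<and> word_value G w = inv g \<otimes> h"
    using ex_word_value[OF assms(1), of "inv g \<otimes> h"] assms by auto
  then have "\<exists>w\<in>lists (symmetrized G A). length w = word_dist G A g h \<and> word_value G w = inv g \<otimes> h"
    unfolding word_dist_def by (rule LeastI_ex)
  then obtain w where w: "w \<in> lists (symmetrized G A)" "length w = word_dist G A g h"
    "word_value G w = inv g \<otimes> h" by blast
  have "g \<otimes> word_value G w = h"
    unfolding w(3) using assms(2,3) by (simp flip: m_assoc)
  with w show ?thesis using that by blast
qed

lemma near_word_dist:
  assumes "finite_generating_set G A" "g \<in> carrier G" "h \<in> carrier G" "word_dist G A g h \<le> n"
  shows "near G A n g h"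
  using shortest_word[OF assms(1-3)] assms(4) unfolding near_def by metis

lemma near_trans:
  assumes "A \<subseteq> carrier G" "g \<in> carrier G" "near G A m g h" "near G A n h k"
  shows "near G A (m + n) g k"
proof -
  have sub: "lists (symmetrized G A) \<subseteq> lists (carrier G)"
    using symmetrized_closed[OF assms(1)] by (rule lists_mono)
  obtain u v where uv: "u \<in> lists (symmetrized G A)" "length u \<le> m" "g \<otimes> word_value G u = h"
    "v \<in> lists (symmetrized G A)" "length v \<le> n" "h \<otimes> word_value G v = k"
    using assms(3,4) unfolding near_def by blast
  have "u \<in> lists (carrier G)" "v \<in> lists (carrier G)" using uv(1,4) sub by blast+
  then have "g \<otimes> word_value G (u @ v) = k"
    using uv(3,6) assms(2) m_assoc[OF assms(2) word_value_closed word_value_closed, of u v] by simp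
  then show ?thesis unfolding near_def using uv by (intro bexI[of _ "u @ v"]) auto
qed

lemma near_sym:
  assumes "A \<subseteq> carrier G" "g \<in> carrier G" "near G A n g h"
  shows "near G A n h g"
proof -
  have sub: "lists (symmetrized G A) \<subseteq> lists (carrier G)"
    using symmetrized_closed[OF assms(1)] by (rule lists_mono)
  obtain u where u: "u \<in> lists (symmetrized G A)" "length u \<le> n" "g \<otimes> word_value G u = h"
    using assms(3) unfolding near_def by blast
  obtain v where v: "v \<in> lists (symmetrized G A)" "length v = length u"
    "word_value G v = inv (word_value G u)"
    using word_value_inverse[OF assms(1) u(1)] by blast
  have "word_value G u \<in> carrier G" using subsetD[OF sub u(1)] by (rule word_value_closed)
  then have "h \<otimes> word_value G v = g"
    using v(3) u(3) assms(2) m_assoc[of g "word_value G u" "inv (word_value G u)"] by simp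
  then show ?thesis unfolding near_def using v u(2) by (intro bexI[of _ v]) simp_all
qed

end

section \<open>Area from a cocycle\<close>

text \<open>
  A 2-cocycle \<open>\<omega>\<close> with integer values is a central extension of the group by the integers in
  coordinates, and the area of a word is the central coordinate of its lift. Replacing a subword
  by another word with the same value changes the area by the difference of the areas of the two
  subwords. So a loop that is filled with few short relators has small area.
\<close>

locale area_cocycle = group G for G :: "('g, 'm) monoid_scheme" (structure) +
  fixes \<omega> :: "'g \<Rightarrow> 'g \<Rightarrow> int"
  assumes cocycle: "\<lbrakk>g \<in> carrier G; h \<in> carrier G; k \<in> carrier G\<rbrakk> \<Longrightarrow>
      \<omega> g h + \<omega> (g \<otimes> h) k = \<omega> h k + \<omega> g (h \<otimes> k)"
    and normalized: "g \<in> carrier G \<Longrightarrow> \<omega> \<one> g = 0"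
begin

primrec area :: "'g list \<Rightarrow> int" where
  "area [] = 0"
| "area (g # w) = \<omega> g (word_value G w) + area w"

lemma area_append:
  assumes "u \<in> lists (carrier G)" "v \<in> lists (carrier G)"
  shows "area (u @ v) = area u + area v + \<omega> (word_value G u) (word_value G v)"
  using assms
proof (induction u)
  case Nil
  then show ?case by (simp add: normalized)
next
  case (Cons g u)
  then show ?case
    using cocycle[of g "word_value G u" "word_value G v"] by simp
qed

lemma area_diff_append:
  assumes "r \<in> lists (carrier G)" "p \<in> lists (carrier G)" "q \<in> lists (carrier G)" "t \<in> lists
      (carrier G)"
    and "word_value G p = word_value G q"
  shows "area (r @ p @ t) - area (r @ q @ t) = area p - area q"
  using assms by (simp add: area_append)

end

text \<open>
  The data of a Cayley automatic representation that the strip argument uses: \<open>hat\<close> spells the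
  letters in the generators, \<open>C\<close> bounds completions, and \<open>E\<close> bounds the distance between the
  element spelled by a word of length at most \<open>N + C\<close> and the element it represents.
\<close>

locale strip = area_cocycle +
  fixes A \<Sigma> L \<psi> \<alpha> hat F and a C E N :: nat
  assumes gens: "finite_generating_set G A"
    and rep: "cayley_automatic_rep G A \<Sigma> L \<psi>"
    and alpha: "\<alpha> \<in> \<Sigma> \<rightarrow> carrier G"
    and hat: "\<And>c. c \<in> \<Sigma> \<Longrightarrow>
      hat c \<in> lists (symmetrized G A) \<and> length (hat c) \<le> a \<and> word_value G (hat c) = \<alpha> c"
    and completion: "\<And>u v s t. \<lbrakk>u \<in> L; v \<in> L; s \<in> symmetrized G A; \<psi> u \<otimes> s = \<psi> v\<rbrakk> \<Longrightarrow>
      \<exists>u' v'. length u' \<le> C \<and> length v' \<le> C \<and> (length u \<le> t \<longrightarrow> u' = []) \<and>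
        take t u @ u' \<in> L \<and> take t v @ v' \<in> L \<and> \<psi> (take t u @ u') \<otimes> s = \<psi> (take t v @ v')"
    and distance: "\<And>w. w \<in> L \<Longrightarrow> length w \<le> N + C \<Longrightarrow>
      word_dist G A (word_value G (map \<alpha> w)) (\<psi> w) \<le> E"
    and area_le: "\<And>w. w \<in> lists (symmetrized G A) \<Longrightarrow> \<bar>area w\<bar> \<le> F (length w)"
    and mono_F: "mono F"
begin

abbreviation "S \<equiv> symmetrized G A"

definition spell :: "nat list \<Rightarrow> 'a list" where
  "spell w = concat (map hat w)"

text \<open>
  The length of a connecting word: along the completion of one prefix, over the gap of at most
  \<open>E\<close> to the element that it represents, across one edge, and back on the other side.
\<close>

definition width :: nat where "width = 2 * a * C + 2 * E + 1"

text \<open>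
  What the area changes by when one side of a piece is replaced by the other: each side is
  a word of at most the length in the argument of \<open>F\<close>.
\<close>

definition err :: int where "err = 2 * F (a + width + E + 1)"

lemma A_closed: "A \<subseteq> carrier G"
  using gens by (simp add: finite_generating_set_def)

lemma S_carrier: "w \<in> lists S \<Longrightarrow> w \<in> lists (carrier G)"
  using lists_mono[OF symmetrized_closed[OF A_closed]] by blast

lemma L_lists: "w \<in> L \<Longrightarrow> w \<in> lists \<Sigma>"
  using rep by (auto simp: cayley_automatic_rep_def regular_language_def)

lemma psi_closed: "w \<in> L \<Longrightarrow> \<psi> w \<in> carrier G"
  using rep by (auto simp: cayley_automatic_rep_def bij_betw_def)

lemma psi_inj: "u \<in> L \<Longrightarrow> v \<in> L \<Longrightarrow> \<psi> u = \<psi> v \<Longrightarrow> u = v"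
  using rep by (auto simp: cayley_automatic_rep_def bij_betw_def inj_on_def)

lemma psi_surj: "g \<in> carrier G \<Longrightarrow> \<exists>w\<in>L. \<psi> w = g"
proof -
  assume "g \<in> carrier G"
  moreover have "\<psi> ` L = carrier G"
    using rep bij_betw_imp_surj_on unfolding cayley_automatic_rep_def by blast
  ultimately have "g \<in> \<psi> ` L" by simp
  then show ?thesis by (auto elim: imageE)
qed

lemma spell_append: "spell (u @ v) = spell u @ spell v"
  by (simp add: spell_def)

lemma spell_lists: "w \<in> lists \<Sigma> \<Longrightarrow> spell w \<in> lists S"
  unfolding spell_def using hat by (induction w) auto

lemma length_spell: "w \<in> lists \<Sigma> \<Longrightarrow> length (spell w) \<le> a * length w"
proof (induction w)
  case (Cons c w)
  then show ?case using hat[of c] by (auto simp: spell_def)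
qed (simp add: spell_def)

lemma map_alpha_closed: "w \<in> lists \<Sigma> \<Longrightarrow> map \<alpha> w \<in> lists (carrier G)"
  using alpha by (induction w) auto

lemma word_value_spell:
  assumes "w \<in> lists \<Sigma>"
  shows "word_value G (spell w) = word_value G (map \<alpha> w)"
  using assms
proof (induction w rule: list.induct)
  case (Cons c w)
  have "spell (c # w) = hat c @ spell w" by (simp add: spell_def)
  moreover have "hat c \<in> lists (carrier G)" "spell w \<in> lists (carrier G)"
    using Cons.prems hat[of c] spell_lists[of w] S_carrier by auto
  ultimately show ?case using Cons hat[of c] by simp
qed (simp add: spell_def)

lemma word_value_spell_closed: "w \<in> lists \<Sigma> \<Longrightarrow> word_value G (spell w) \<in> carrier G"
  by (intro word_value_closed S_carrier spell_lists)

text \<open>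
  The prefixes of related words travel together: both extend by boundedly many letters to a related
  pair, and each word of that pair spells almost the element that it represents.
\<close>

lemma prefixes_near:
  assumes "u \<in> L" "v \<in> L" "s \<in> S" "\<psi> u \<otimes> s = \<psi> v" "length u \<le> N" "length v \<le> N"
  shows "near G A width (word_value G (spell (take t u))) (word_value G (spell (take t v)))"
proof -
  obtain u' v' where e: "length u' \<le> C" "length v' \<le> C" "take t u @ u' \<in> L" "take t v @ v' \<in> L"
    and rel: "\<psi> (take t u @ u') \<otimes> s = \<psi> (take t v @ v')"
    using completion[OF assms(1-4), of t] by blast
  let ?val = "\<lambda>w. word_value G (spell w)"
  have ext: "near G A (a * C) (?val p) (?val (p @ q)) \<and> ?val p \<in> carrier G \<and> ?val (p @ q)
      \<in> carrier G"
    if "p @ q \<in> L" "length q \<le> C" for p q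
  proof -
    have pq: "p \<in> lists \<Sigma>" "q \<in> lists \<Sigma>" using L_lists[OF that(1)] by auto
    have "length (spell q) \<le> a * C"
      using length_spell[OF pq(2)] that(2) by (meson mult_le_mono2 order_trans)
    then have "near G A (a * C) (?val p) (?val (p @ q))"
      unfolding near_def using spell_lists[OF pq(2)] spell_lists[OF pq(1)] S_carrier
      by (intro bexI[of _ "spell q"]) (simp_all add: spell_append del: in_lists_conv_set)
    then show ?thesis using pq word_value_spell_closed[of p] word_value_spell_closed[of "p @ q"]
        by simp
  qed
  have close: "near G A E (?val w) (\<psi> w)" if "w \<in> L" "length w \<le> N + C" for w
    using near_word_dist[OF gens word_value_spell_closed psi_closed] distance[OF that] that L_lists
      word_value_spell by simp
  have len: "length (take t u @ u') \<le> N + C" "length (take t v @ v') \<le> N + C"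
    using assms(5,6) e(1,2) by auto
  note u = ext[OF e(3,1)] and v = ext[OF e(4,2)]
  have 1: "near G A (a * C + E) (?val (take t u)) (\<psi> (take t u @ u'))"
    using u close[OF e(3) len(1)] near_trans[OF A_closed] by blast
  have 2: "near G A (a * C + E) (?val (take t v)) (\<psi> (take t v @ v'))"
    using v close[OF e(4) len(2)] near_trans[OF A_closed] by blast
  have 3: "near G A 1 (\<psi> (take t u @ u')) (\<psi> (take t v @ v'))"
    unfolding near_def using assms(3) rel symmetrized_closed[OF A_closed]
    by (intro bexI[of _ "[s]"]) auto
  have "near G A (a * C + E + 1 + (a * C + E)) (?val (take t u)) (?val (take t v))"
    using near_trans[OF A_closed _ near_trans[OF A_closed _ 1 3] near_sym[OF A_closed _ 2]] u v
        by blast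
  moreover have "a * C + E + 1 + (a * C + E) = width" by (simp add: width_def)
  ultimately show ?thesis by simp
qed

lemma parallel_area:
  assumes "p \<in> lists S" "q \<in> lists S" "length p \<le> a + width + E + 1" "length q \<le> a + width + E + 1"
  shows "\<bar>area p - area q\<bar> \<le> err"
proof -
  have "F (length p) \<le> F (a + width + E + 1)" "F (length q) \<le> F (a + width + E + 1)"
    using assms(3,4) mono_F by (auto dest: monoD)
  then show ?thesis using area_le[OF assms(1)] area_le[OF assms(2)] unfolding err_def by linarith
qed

lemma err_nonneg: "0 \<le> err"
  using parallel_area[of "[]" "[]"] by simp

text \<open>
  The strip between the paths spelled by two related words is cut into short pieces by
  connecting words between their prefixes (\<open>prefixes_near\<close>), one for each letter.
\<close>

lemma strip_area:
  assumes "u \<in> L" "v \<in> L" "s \<in> S" "\<psi> u \<otimes> s = \<psi> v" "length u \<le> N" "length v \<le> N"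
    and "c \<in> lists S" "length c \<le> width"
    and "word_value G (spell (take t u) @ c) = word_value G (spell (take t v))"
  shows "\<bar>area (spell (take t u) @ c) - area (spell (take t v))\<bar> \<le> int (t + 1) * err"
  using assms(7-)
proof (induction t arbitrary: c)
  case 0
  then show ?case using parallel_area[of c "[]"] by (simp add: spell_def)
next
  case (Suc t)
  have ul: "u \<in> lists \<Sigma>" and vl: "v \<in> lists \<Sigma>" using assms(1,2) L_lists by auto
  have take_Suc: "\<exists>p\<in>lists S. length p \<le> a \<and> spell (take (Suc t) w) = spell (take t w) @ p"
    if "w \<in> lists \<Sigma>" for w
  proof (cases "t < length w")
    case True
    then have "w ! t \<in> \<Sigma>" using that by auto
    then show ?thesis
      using True hat[of "w ! t"]
      by (intro bexI[of _ "hat (w ! t)"]) (auto simp: take_Suc_conv_app_nth spell_def)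
  next
    case False
    then show ?thesis by (intro bexI[of _ "[]"]) auto
  qed
  obtain p where p: "p \<in> lists S" "length p \<le> a" "spell (take (Suc t) u) = spell (take t u) @ p"
    using take_Suc[OF ul] by blast
  obtain q where q: "q \<in> lists S" "length q \<le> a" "spell (take (Suc t) v) = spell (take t v) @ q"
    using take_Suc[OF vl] by blast
  obtain d where d: "d \<in> lists S" "length d \<le> width"
    "word_value G (spell (take t u)) \<otimes> word_value G d = word_value G (spell (take t v))"
    using prefixes_near[OF assms(1-6), of t] unfolding near_def by blast
  have lists: "spell (take t u) \<in> lists S" "spell (take t v) \<in> lists S"
    using ul vl by (auto intro!: spell_lists dest: in_set_takeD)
  note carrier = lists[THEN S_carrier] S_carrier[OF p(1)] S_carrier[OF q(1)] S_carrier[OF d(1)]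
    S_carrier[OF Suc.prems(1)]
  have d': "word_value G (spell (take t u) @ d) = word_value G (spell (take t v))"
    using d(3) carrier by simp
  have "word_value G (spell (take t u)) \<otimes> word_value G (p @ c)
      = word_value G (spell (take t u)) \<otimes> word_value G (d @ q)"
    using Suc.prems(3) d(3) carrier unfolding p(3) q(3)
    by (simp add: m_assoc[symmetric] del: in_lists_conv_set)
  then have par: "word_value G (p @ c) = word_value G (d @ q)"
    using carrier by (simp del: in_lists_conv_set word_value_append)
  have "area (spell (take t u) @ (p @ c) @ []) - area (spell (take t u) @ (d @ q) @ [])
      = area (p @ c) - area (d @ q)"
    by (rule area_diff_append) (use carrier par in auto)
  moreover have "\<bar>area (p @ c) - area (d @ q)\<bar> \<le> err"
    by (rule parallel_area) (use p(1,2) q(1,2) d(1,2) Suc.prems(1,2) in auto)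
  moreover have "area ([] @ (spell (take t u) @ d) @ q) - area ([] @ spell (take t v) @ q)
      = area (spell (take t u) @ d) - area (spell (take t v))"
    by (rule area_diff_append) (use carrier d' in auto)
  moreover have "\<bar>area (spell (take t u) @ d) - area (spell (take t v))\<bar> \<le> int (t + 1) * err"
    using Suc.IH[OF d(1,2) d'] .
  ultimately show ?case
    unfolding p(3) q(3) by (simp add: algebra_simps)
qed

definition tail_word :: "nat list \<Rightarrow> 'a list" where
  "tail_word u = (SOME r. r \<in> lists S \<and> length r = word_dist G A (word_value G (map \<alpha> u)) (\<psi> u) \<and>
     word_value G (map \<alpha> u) \<otimes> word_value G r = \<psi> u)"

text \<open>
  Unlike the word that merely spells \<open>u\<close>, this one ends in \<open>\<psi> u\<close>. It depends on \<open>u\<close> only, so along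
  a closed path the last of these words is the first one again.
\<close>

definition full :: "nat list \<Rightarrow> 'a list" where
  "full u = spell u @ tail_word u"

lemma tail_word:
  assumes "u \<in> L"
  shows "tail_word u \<in> lists S" "length (tail_word u) = word_dist G A (word_value G (map \<alpha> u))
      (\<psi> u)"
    "word_value G (map \<alpha> u) \<otimes> word_value G (tail_word u) = \<psi> u"
proof -
  have "word_value G (map \<alpha> u) \<in> carrier G"
    using map_alpha_closed[OF L_lists[OF assms]] by (rule word_value_closed)
  then have "\<exists>r. r \<in> lists S \<and> length r = word_dist G A (word_value G (map \<alpha> u)) (\<psi> u) \<and>
     word_value G (map \<alpha> u) \<otimes> word_value G r = \<psi> u"
    using shortest_word[OF gens _ psi_closed[OF assms]] by metis
  then have "tail_word u \<in> lists S \<and>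
      length (tail_word u) = word_dist G A (word_value G (map \<alpha> u)) (\<psi> u) \<and>
      word_value G (map \<alpha> u) \<otimes> word_value G (tail_word u) = \<psi> u"
    unfolding tail_word_def by (rule someI_ex)
  then show "tail_word u \<in> lists S"
    "length (tail_word u) = word_dist G A (word_value G (map \<alpha> u)) (\<psi> u)"
    "word_value G (map \<alpha> u) \<otimes> word_value G (tail_word u) = \<psi> u"
    by auto
qed

lemma full:
  assumes "u \<in> L"
  shows "full u \<in> lists S" "word_value G (full u) = \<psi> u"
proof -
  show "full u \<in> lists S"
    unfolding full_def using tail_word(1)[OF assms] spell_lists[OF L_lists[OF assms]] by simp
  show "word_value G (full u) = \<psi> u"
    unfolding full_def
    using tail_word[OF assms] spell_lists[OF L_lists[OF assms]] word_value_spell[OF L_lists[OF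
        assms]]
      S_carrier by simp
qed

lemma full_step:
  assumes "u \<in> L" "v \<in> L" "s \<in> S" "\<psi> u \<otimes> s = \<psi> v" "length u \<le> N" "length v \<le> N"
  shows "\<bar>area (full u @ [s]) - area (full v)\<bar> \<le> int (N + 2) * err"
proof -
  obtain c where c: "c \<in> lists S" "length c \<le> width"
    "word_value G (spell (take N u)) \<otimes> word_value G c = word_value G (spell (take N v))"
    using prefixes_near[OF assms, of N] unfolding near_def by blast
  have ul: "spell u \<in> lists S" "spell v \<in> lists S" "tail_word u \<in> lists S" "tail_word v \<in> lists S"
    using assms(1,2) spell_lists L_lists tail_word(1) by blast+
  note carrier = ul[THEN S_carrier] S_carrier[OF c(1)]
  have s: "s \<in> carrier G" using assms(3) symmetrized_closed[OF A_closed] by blast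
  have len: "length (tail_word u) \<le> E" "length (tail_word v) \<le> E"
    using tail_word(2) distance assms(1,2,5,6) by auto
  have cval: "word_value G (spell u @ c) = word_value G (spell v)"
    using c(3) carrier assms(5,6) by simp
  have "word_value G (spell u) \<otimes> word_value G (tail_word u @ [s]) = \<psi> v"
    using full(2)[OF assms(1)] assms(4) carrier s unfolding full_def by
        (simp add: m_assoc[symmetric])
  moreover have "word_value G (spell u) \<otimes> word_value G (c @ tail_word v) = \<psi> v"
    using full(2)[OF assms(2)] cval carrier unfolding full_def by (simp add: m_assoc[symmetric])
  ultimately have "word_value G (spell u) \<otimes> word_value G (tail_word u @ [s])
      = word_value G (spell u) \<otimes> word_value G (c @ tail_word v)" by simp
  then have par: "word_value G (tail_word u @ [s]) = word_value G (c @ tail_word v)"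
    using carrier s by (simp del: word_value_append)
  have "area (spell u @ (tail_word u @ [s]) @ []) - area (spell u @ (c @ tail_word v) @ [])
      = area (tail_word u @ [s]) - area (c @ tail_word v)"
    by (rule area_diff_append) (use carrier s par in auto)
  moreover have "\<bar>area (tail_word u @ [s]) - area (c @ tail_word v)\<bar> \<le> err"
    by (rule parallel_area) (use c(1,2) ul len assms(3) in auto)
  moreover have "area ([] @ (spell u @ c) @ tail_word v) - area ([] @ spell v @ tail_word v)
      = area (spell u @ c) - area (spell v)"
    by (rule area_diff_append) (use carrier cval in auto)
  moreover have "\<bar>area (spell u @ c) - area (spell v)\<bar> \<le> int (N + 1) * err"
    using strip_area[OF assms c(1,2), of N] cval assms(5,6) by simp
  ultimately show ?thesis
    unfolding full_def by (simp add: algebra_simps)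
qed

text \<open>
  The words of \<open>L\<close> along a path grow by at most \<open>C\<close> letters per edge: complete the
  second word right after the first one has ended, and use that \<open>\<psi>\<close> is injective.
\<close>

lemma length_step:
  assumes "u \<in> L" "v \<in> L" "s \<in> S" "\<psi> u \<otimes> s = \<psi> v"
  shows "length v \<le> length u + C"
proof -
  obtain v' where v': "length v' \<le> C" "take (length u) v @ v' \<in> L" "\<psi> u \<otimes> s = \<psi> (take
      (length u) v @ v')"
    using completion[OF assms, of "length u"] by auto
  then have "v = take (length u) v @ v'" using psi_inj assms(2,4) by metis
  then have "length v = length (take (length u) v @ v')" by simp
  then show ?thesis using v'(1) by auto
qed

lemma path_area:
  assumes "u0 \<in> L" "w \<in> lists S" "length u0 + C * length w \<le> N"
  shows "\<exists>u\<in>L. \<psi> u = \<psi> u0 \<otimes> word_value G w \<and> length u \<le> length u0 + C * length w \<and>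
    \<bar>area (full u0 @ w) - area (full u)\<bar> \<le> int (length w) * (int (N + 2) * err)"
  using assms(2,3)
proof (induction w rule: rev_induct)
  case Nil
  then show ?case using assms(1) psi_closed by (intro bexI[of _ u0]) auto
next
  case (snoc s w)
  then obtain u where u: "u \<in> L" "\<psi> u = \<psi> u0 \<otimes> word_value G w" "length u \<le> length u0 + C * length w"
    "\<bar>area (full u0 @ w) - area (full u)\<bar> \<le> int (length w) * (int (N + 2) * err)"
    by auto
  have s: "s \<in> S" "s \<in> carrier G" and wl: "w \<in> lists (carrier G)"
    using snoc.prems(1) symmetrized_closed[OF A_closed] S_carrier[of w] by auto
  obtain v where v: "v \<in> L" "\<psi> v = \<psi> u \<otimes> s" using psi_surj[of "\<psi> u \<otimes> s"] psi_closed[OF u(1)] s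
      by auto
  have len: "length v \<le> length u0 + C * length (w @ [s])"
    using length_step[OF u(1) v(1) s(1)] v(2) u(3) by simp
  have step: "\<bar>area (full u @ [s]) - area (full v)\<bar> \<le> int (N + 2) * err"
    using u(3) len snoc.prems(2) by (intro full_step u v s) (auto simp: v(2))
  have "area ([] @ (full u0 @ w) @ [s]) - area ([] @ full u @ [s]) = area (full u0 @ w) - area
      (full u)"
    using S_carrier[OF full(1)[OF assms(1)]] S_carrier[OF full(1)[OF u(1)]] wl s(2) u(2)
    by (intro area_diff_append) (simp_all add: full assms(1) u(1))
  then have "\<bar>area (full u0 @ w @ [s]) - area (full v)\<bar> \<le> int (length (w @ [s])) * (int
      (N + 2) * err)"
    using u(4) step by (simp add: algebra_simps)
  moreover have "\<psi> v = \<psi> u0 \<otimes> word_value G (w @ [s])"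
    using v(2) u(2) wl s(2) psi_closed[OF assms(1)] by (simp add: m_assoc)
  ultimately show ?case using v(1) len by blast
qed

text \<open>
  Around a loop the path returns to the word it started from, so the errors of
  \<open>path_area\<close> bound the area of the loop itself.
\<close>

lemma loop_area:
  assumes "u0 \<in> L" "\<psi> u0 = \<one>" "w \<in> lists S" "length u0 + C * length w \<le> N" "word_value G w = \<one>"
  shows "\<bar>area w\<bar> \<le> int (length w) * (int (N + 2) * err)"
proof -
  obtain u where u: "u \<in> L" "\<psi> u = \<psi> u0 \<otimes> word_value G w"
    "\<bar>area (full u0 @ w) - area (full u)\<bar> \<le> int (length w) * (int (N + 2) * err)"
    using path_area[OF assms(1,3,4)] by blast
  then have "u = u0" using psi_inj[OF u(1) assms(1)] assms(2,5) by simp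
  moreover have "area (full u0 @ w) = area (full u0) + area w"
    using area_append[OF S_carrier S_carrier, of "full u0" w] full[OF assms(1)] assms(2,3)
      normalized[of "word_value G w"] S_carrier[OF assms(3)] by simp
  ultimately show ?thesis using u(3) by simp
qed

end

section \<open>The Heisenberg group is separated from automatic groups\<close>

text \<open>
  The central extension behind this cocycle is nilpotent of class 3: the new central coordinate
  is \<open>l + l' + 2 i k' + i\<^sup>2 j'\<close>.
\<close>

definition engel_cocycle :: "nat \<Rightarrow> nat \<Rightarrow> int" where
  "engel_cocycle g h = 2 * xco g * zco h + (xco g)\<^sup>2 * yco h"

interpretation engel: area_cocycle heisenberg engel_cocycle
  by unfold_locales
    (auto simp: engel_cocycle_def coordinates_mult coordinates_one power2_eq_square algebra_simps)

abbreviation heis_letters :: "nat set" where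
  "heis_letters \<equiv> symmetrized heisenberg heisenberg_gens"

lemma heis_letter_coordinates:
  assumes "s \<in> heis_letters"
  shows "\<bar>xco s\<bar> \<le> 1" "\<bar>yco s\<bar> \<le> 1" "zco s = 0"
  using assms by (auto simp: symmetrized_heisenberg_gens xgen_def ygen_def)

text \<open>
  One more letter changes the area by at most the square of the first coordinate, and that
  coordinate is bounded by the length.
\<close>

lemma area_le_cube:
  assumes "w \<in> lists heis_letters"
  shows "\<bar>xco (word_value heisenberg w)\<bar> \<le> int (length w) \<and> \<bar>engel.area w\<bar> \<le> int (length w) ^ 3"
  using assms
proof (induction w rule: rev_induct)
  case Nil
  then show ?case by (simp add: coordinates_one)
next
  case (snoc s w)
  let ?x = "xco (word_value heisenberg w)" and ?n = "int (length w)"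
  have s: "s \<in> heis_letters" using snoc.prems by simp
  have IH: "\<bar>?x\<bar> \<le> ?n" "\<bar>engel.area w\<bar> \<le> ?n ^ 3" using snoc by simp_all
  have "word_value heisenberg (w @ [s]) = word_value heisenberg w \<otimes>\<^bsub>heisenberg\<^esub> s"
    by simp
  then have "\<bar>xco (word_value heisenberg (w @ [s]))\<bar> \<le> ?n + 1"
    using IH(1) heis_letter_coordinates(1)[OF s] by (simp add: coordinates_mult)
  moreover have area: "engel.area (w @ [s]) = engel.area w + ?x\<^sup>2 * yco s"
    using heis_letter_coordinates(3)[OF s]
    by (simp add: engel.area_append engel_cocycle_def coordinates_one)
  have "?x\<^sup>2 \<le> ?n\<^sup>2" using IH(1) by (simp add: abs_le_square_iff flip: abs_le_square_iff)
  then have "\<bar>?x\<^sup>2 * yco s\<bar> \<le> ?n\<^sup>2 * 1"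
    unfolding abs_mult using heis_letter_coordinates(2)[OF s] by (intro mult_mono) auto
  then have "\<bar>engel.area (w @ [s])\<bar> \<le> ?n ^ 3 + ?n\<^sup>2" using area IH(2) by linarith
  moreover have "?n ^ 3 + ?n\<^sup>2 \<le> (?n + 1) ^ 3"
    by (simp add: power3_eq_cube power2_eq_square algebra_simps)
  ultimately show ?case by (simp add: add.commute)
qed

text \<open>
  The loop \<open>[x\<^sup>n, [x\<^sup>n, y\<^sup>n]]\<close>: it is trivial since \<open>z\<close> is central, but its area is cubic, while its
  length is linear.
\<close>

definition engel_loop :: "nat \<Rightarrow> nat list" where
  "engel_loop n = (let x = replicate n (xgen 1); X = replicate n (xgen (-1));
      y = replicate n (ygen 1); Y = replicate n (ygen (-1))
    in x @ (x @ y @ X @ Y) @ X @ (y @ x @ Y @ X))"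

lemma power_word_value:
  "word_value heisenberg (replicate n (xgen e)) = triple (e * int n) 0 0"
  "word_value heisenberg (replicate n (ygen e)) = triple 0 (e * int n) 0"
  by (induction n) (auto simp: one_heisenberg xgen_def ygen_def algebra_simps)

lemma power_word_area:
  "engel.area (replicate n (xgen e)) = 0" "engel.area (replicate n (ygen e)) = 0"
  by (induction n) (auto simp: power_word_value engel_cocycle_def coordinates_gen)

lemma engel_loop:
  "engel_loop n \<in> lists heis_letters" "length (engel_loop n) = 10 * n"
  "word_value heisenberg (engel_loop n) = \<one>\<^bsub>heisenberg\<^esub>" "engel.area (engel_loop n) = 2 * int n ^ 3"
  unfolding engel_loop_def Let_def
  by (auto simp: symmetrized_heisenberg_gens power_word_value power_word_area engel.area_append
      one_heisenberg engel_cocycle_def power2_eq_square power3_eq_cube algebra_simps)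

lemma uniform_completion:
  assumes "finite_generating_set G A" "cayley_automatic_rep G A \<Sigma> L \<psi>"
  shows "\<exists>C. \<forall>s\<in>symmetrized G A. \<forall>u\<in>L. \<forall>v\<in>L. \<forall>t. \<psi> u \<otimes>\<^bsub>G\<^esub> s = \<psi> v \<longrightarrow>
    (\<exists>u' v'. length u' \<le> C \<and> length v' \<le> C \<and> (length u \<le> t \<longrightarrow> u' = []) \<and>
       take t u @ u' \<in> L \<and> take t v @ v' \<in> L \<and> \<psi> (take t u @ u') \<otimes>\<^bsub>G\<^esub> s = \<psi> (take t v @ v'))"
proof -
  let ?S = "symmetrized G A"
  let ?P = "\<lambda>C s u v t u' v'. length u' \<le> C \<and> length v' \<le> C \<and> (length u \<le> t \<longrightarrow> u' = []) \<and>
    take t u @ u' \<in> L \<and> take t v @ v' \<in> L \<and> \<psi> (take t u @ u') \<otimes>\<^bsub>G\<^esub> s = \<psi> (take t v @ v')"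
  have "\<exists>C. \<forall>u\<in>L. \<forall>v\<in>L. \<forall>t. \<psi> u \<otimes>\<^bsub>G\<^esub> s = \<psi> v \<longrightarrow> (\<exists>u' v'. ?P C s u v t u' v')"
    if "s \<in> ?S" for s
  proof -
    have "synchronously_recognized \<Sigma> {(u, v). u \<in> L \<and> v \<in> L \<and> \<psi> u \<otimes>\<^bsub>G\<^esub> s = \<psi> v}"
      using assms(2) that by (simp add: cayley_automatic_rep_def)
    from synchronous_completion[OF this] obtain C where
      "\<forall>u v t. (u, v) \<in> {(u, v). u \<in> L \<and> v \<in> L \<and> \<psi> u \<otimes>\<^bsub>G\<^esub> s = \<psi> v} \<longrightarrow>
         (\<exists>u' v'. length u' \<le> C \<and> length v' \<le> C \<and> (length u \<le> t \<longrightarrow> u' = []) \<and>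
           (take t u @ u', take t v @ v') \<in> {(u, v). u \<in> L \<and> v \<in> L \<and> \<psi> u \<otimes>\<^bsub>G\<^esub> s = \<psi> v})"
      by (rule exE)
    then show ?thesis by (intro exI[of _ C]) simp
  qed
  then obtain c where c: "\<And>s u v t. \<lbrakk>s \<in> ?S; u \<in> L; v \<in> L; \<psi> u \<otimes>\<^bsub>G\<^esub> s = \<psi> v\<rbrakk> \<Longrightarrow>
      \<exists>u' v'. ?P (c s) s u v t u' v'"
    by metis
  have "finite ?S" using assms(1) by (simp add: finite_generating_set_def symmetrized_def)
  then have le: "c s \<le> sum c ?S" if "s \<in> ?S" for s using that by (intro member_le_sum) auto
  show ?thesis
  proof (intro exI[of _ "sum c ?S"] ballI allI impI)
    fix s u v t
    assume a: "s \<in> ?S" "u \<in> L" "v \<in> L" "\<psi> u \<otimes>\<^bsub>G\<^esub> s = \<psi> v"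
    obtain u' v' where "?P (c s) s u v t u' v'" using c[OF a] by blast
    then have "?P (sum c ?S) s u v t u' v'" using le[OF a(1)] by auto
    then show "\<exists>u' v'. ?P (sum c ?S) s u v t u' v'" by blast
  qed
qed

lemma (in group) ex_letter_words:
  assumes "finite_generating_set G A" "finite \<Sigma>" "\<alpha> \<in> \<Sigma> \<rightarrow> carrier G"
  shows "\<exists>hat a. \<forall>c\<in>\<Sigma>. hat c \<in> lists (symmetrized G A) \<and> length (hat c) \<le> a \<and> word_value G (hat c)
      = \<alpha> c"
proof -
  have "\<forall>c\<in>\<Sigma>. \<exists>w. w \<in> lists (symmetrized G A) \<and> word_value G w = \<alpha> c"
    using ex_word_value[OF assms(1)] assms(3) by blast
  then obtain hat where hat: "\<forall>c\<in>\<Sigma>. hat c \<in> lists (symmetrized G A) \<and> word_value G (hat c) = \<alpha> c"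
    by metis
  have "length (hat c) \<le> (\<Sum>c\<in>\<Sigma>. length (hat c))" if "c \<in> \<Sigma>" for c
    using that assms(2) by (intro member_le_sum) auto
  with hat show ?thesis by blast
qed

lemma finite_bounded_words:
  assumes "finite \<Sigma>" "L \<subseteq> lists \<Sigma>"
  shows "finite {w \<in> L. length w \<le> n}"
proof (rule finite_subset)
  show "finite {w. set w \<subseteq> \<Sigma> \<and> length w \<le> n}" by (rule finite_lists_length_le[OF assms(1)])
  show "{w \<in> L. length w \<le> n} \<subseteq> {w. set w \<subseteq> \<Sigma> \<and> length w \<le> n}" using assms(2) by auto
qed

lemma cayley_distance_ge:
  assumes "finite \<Sigma>" "L \<subseteq> lists \<Sigma>" "w \<in> L" "length w \<le> n"
  shows "real (word_dist G A (word_value G (map \<alpha> w)) (\<psi> w)) \<le> cayley_distance G A L \<psi> \<alpha> n"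
proof -
  have "finite {word_dist G A (word_value G (map \<alpha> w)) (\<psi> w) | w. w \<in> L \<and> length w \<le> n}"
    using finite_imageI[OF finite_bounded_words[OF assms(1,2), of n],
        of "\<lambda>w. word_dist G A (word_value G (map \<alpha> w)) (\<psi> w)"]
    by (simp add: setcompr_eq_image)
  then have "word_dist G A (word_value G (map \<alpha> w)) (\<psi> w)
      \<le> Max {word_dist G A (word_value G (map \<alpha> w)) (\<psi> w) | w. w \<in> L \<and> length w \<le> n}"
    using assms(3,4) by (intro Max_ge) auto
  then show ?thesis unfolding cayley_distance_def by simp
qed

text \<open>
  Filling the loop of length \<open>10 n\<close> with strips: there are \<open>O(n)\<close> strips, each is cut into \<open>O(n)\<close>
  pieces, and a piece has area at most cubic in the Cayley distance. Comparing with the area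
  \<open>2 n\<^sup>3\<close> leaves \<open>n\<close> at most cubic in the Cayley distance.
\<close>

lemma heisenberg_distance_bound:
  assumes rep: "cayley_automatic_rep heisenberg heisenberg_gens \<Sigma> L \<psi>"
    and alpha: "\<alpha> \<in> \<Sigma> \<rightarrow> carrier heisenberg"
  shows "\<exists>C>0. \<forall>n H. (\<forall>w\<in>L. length w \<le> C * (n + 1) \<longrightarrow>
      word_dist heisenberg heisenberg_gens (word_value heisenberg (map \<alpha> w)) (\<psi> w) \<le> H) \<longrightarrow>
    n \<le> C * (C + 3 * H) ^ 3"
proof -
  note fg = finite_generating_set_heisenberg
  obtain C where completion: "\<forall>s\<in>heis_letters. \<forall>u\<in>L. \<forall>v\<in>L. \<forall>t. \<psi> u \<otimes>\<^bsub>heisenberg\<^esub> s = \<psi> v \<longrightarrow>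
      (\<exists>u' v'. length u' \<le> C \<and> length v' \<le> C \<and> (length u \<le> t \<longrightarrow> u' = []) \<and>
        take t u @ u' \<in> L \<and> take t v @ v' \<in> L \<and>
        \<psi> (take t u @ u') \<otimes>\<^bsub>heisenberg\<^esub> s = \<psi> (take t v @ v'))"
    by (rule exE[OF uniform_completion[OF fg rep]])
  have "finite \<Sigma>" using rep by (simp add: cayley_automatic_rep_def)
  then obtain hat a where hat: "\<And>c. c \<in> \<Sigma> \<Longrightarrow> hat c \<in> lists heis_letters \<and> length (hat c) \<le> a \<and>
      word_value heisenberg (hat c) = \<alpha> c"
    using heisenberg.ex_letter_words[OF fg _ alpha] by blast
  have "bij_betw \<psi> L (carrier heisenberg)" using rep by (simp add: cayley_automatic_rep_def)
  then have "\<one>\<^bsub>heisenberg\<^esub> \<in> \<psi> ` L" by (simp add: bij_betw_imp_surj_on)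
  then obtain u0 where u0: "u0 \<in> L" "\<psi> u0 = \<one>\<^bsub>heisenberg\<^esub>" by auto
  \<comment> \<open>For a loop of length \<open>10 n\<close> the words have at most \<open>N = length u0 + 10 C n\<close> letters; \<open>D (n + 1)\<close>
    dominates \<open>N + 2\<close>, and \<open>D + 3 H\<close> dominates the length of a side of a piece.\<close>
  define D where "D = length u0 + 11 * C + 2 + a + 2 * a * C"
  show ?thesis
  proof (intro exI[of _ "20 * D"] conjI allI impI)
    show "0 < 20 * D" by (simp add: D_def)
    fix n H
    assume H: "\<forall>w\<in>L. length w \<le> 20 * D * (n + 1) \<longrightarrow>
      word_dist heisenberg heisenberg_gens (word_value heisenberg (map \<alpha> w)) (\<psi> w) \<le> H"
    define N where "N = length u0 + C * (10 * n)"
    have "N + C \<le> 20 * D * (n + 1)" "N + 2 \<le> D * (n + 1)"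
      by (simp_all add: N_def D_def algebra_simps)
    interpret strip heisenberg engel_cocycle heisenberg_gens \<Sigma> L \<psi> \<alpha> hat "\<lambda>n. int n ^ 3" a C H N
    proof unfold_locales
      show "word_dist heisenberg heisenberg_gens (word_value heisenberg (map \<alpha> w)) (\<psi> w) \<le> H"
        if "w \<in> L" "length w \<le> N + C" for w
        using H that \<open>N + C \<le> 20 * D * (n + 1)\<close> by auto
      show "mono (\<lambda>n. int n ^ 3)" by (intro monoI power_mono) auto
      show "\<exists>u' v'. length u' \<le> C \<and> length v' \<le> C \<and> (length u \<le> t \<longrightarrow> u' = []) \<and>
          take t u @ u' \<in> L \<and> take t v @ v' \<in> L \<and>
          \<psi> (take t u @ u') \<otimes>\<^bsub>heisenberg\<^esub> s = \<psi> (take t v @ v')"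
        if "u \<in> L" "v \<in> L" "s \<in> heis_letters" "\<psi> u \<otimes>\<^bsub>heisenberg\<^esub> s = \<psi> v" for u v s t
        by (rule completion[rule_format, OF that(3,1,2,4)])
      show "\<bar>engel.area w\<bar> \<le> int (length w) ^ 3" if "w \<in> lists heis_letters" for w
        using area_le_cube[OF that] by (rule conjunct2)
    qed (fact fg rep alpha | erule hat)+
    have width: "a + width + H + 1 \<le> D + 3 * H" by (simp add: width_def D_def)
    show "n \<le> 20 * D * (20 * D + 3 * H) ^ 3"
    proof (cases "n = 0")
      case False
      have "2 * int n ^ 3 \<le> int (10 * n) * (int (N + 2) * err)"
        using loop_area[OF u0 engel_loop(1)[of n] _ engel_loop(3)]
        by (simp add: engel_loop(2,4) N_def)
      also have "\<dots> \<le> int (10 * n) * (int (D * (2 * n)) * (2 * int (D + 3 * H) ^ 3))"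
      proof (intro mult_left_mono mult_mono)
        show "int (N + 2) \<le> int (D * (2 * n))"
        proof -
          have "n + 1 \<le> 2 * n" using False by simp
          then have "D * (n + 1) \<le> D * (2 * n)" by (rule mult_le_mono2)
          then show ?thesis using \<open>N + 2 \<le> D * (n + 1)\<close> by linarith
        qed
        have "int (a + width + H + 1) ^ 3 \<le> int (D + 3 * H) ^ 3"
          using width by (intro power_mono) auto
        then show "err \<le> 2 * int (D + 3 * H) ^ 3" unfolding err_def by simp
      qed (use err_nonneg in auto)
      also have "\<dots> = 2 * (int n)\<^sup>2 * int (20 * D * (D + 3 * H) ^ 3)"
        by (simp add: power2_eq_square)
      finally have "2 * (int n)\<^sup>2 * int n \<le> 2 * (int n)\<^sup>2 * int (20 * D * (D + 3 * H) ^ 3)"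
        by (simp add: power2_eq_square power3_eq_cube mult.assoc)
      then have "int n \<le> int (20 * D * (D + 3 * H) ^ 3)"
        using False by (subst (asm) mult_le_cancel_left_pos) auto
      then have "n \<le> 20 * D * (D + 3 * H) ^ 3" by linarith
      also have "\<dots> \<le> 20 * D * (20 * D + 3 * H) ^ 3"
        by (intro mult_le_mono2 power_mono) auto
      finally show ?thesis .
    qed simp
  qed
qed

lemma separated_heisenberg: "separated_from_automatic heisenberg heisenberg_gens"
  unfolding separated_from_automatic_def
proof (intro exI[of _ 0] exI[of _ "\<lambda>n. root 3 (real n)"] conjI allI impI)
  show "mono_on {0..} (\<lambda>n. root 3 (real n))" by (auto intro!: mono_onI)
  show "\<not> bdd_above ((\<lambda>n. root 3 (real n)) ` {0..})"
  proof
    assume "bdd_above ((\<lambda>n. root 3 (real n)) ` {0..})"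
    then obtain B where B: "\<And>n::nat. root 3 (real n) \<le> B" by (auto simp: bdd_above_def)
    obtain m :: nat where m: "B < real m" using reals_Archimedean2 by blast
    have "root 3 (real (m ^ 3)) = real m" by (simp add: real_root_power_cancel)
    then show False using B[of "m ^ 3"] m by simp
  qed
next
  fix \<Sigma> :: "nat set" and L \<psi> \<alpha>
  assume "cayley_automatic_rep heisenberg heisenberg_gens \<Sigma> L \<psi> \<and> \<alpha> \<in> \<Sigma> \<rightarrow> carrier heisenberg"
  then have rep: "cayley_automatic_rep heisenberg heisenberg_gens \<Sigma> L \<psi>"
    and alpha: "\<alpha> \<in> \<Sigma> \<rightarrow> carrier heisenberg" by auto
  have fin: "finite \<Sigma>" and L: "L \<subseteq> lists \<Sigma>"
    using rep by (auto simp: cayley_automatic_rep_def regular_language_def)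
  let ?d = "\<lambda>w. word_dist heisenberg heisenberg_gens (word_value heisenberg (map \<alpha> w)) (\<psi> w)"
  let ?h = "cayley_distance heisenberg heisenberg_gens L \<psi> \<alpha>"
  obtain C where C: "C > 0" "\<And>n H. (\<And>w. w \<in> L \<Longrightarrow> length w \<le> C * (n + 1) \<Longrightarrow> ?d w \<le> H) \<Longrightarrow>
      n \<le> C * (C + 3 * H) ^ 3"
    using heisenberg_distance_bound[OF rep alpha] by blast
  define N0 where "N0 = max (cayley_distance_start L) (C * C ^ 3 + 1)"
  have "root 3 (real n) \<le> real (C * (C + 3)) * ?h (2 * C * n)" if n: "n \<ge> N0" for n
  proof -
    \<comment> \<open>The distance function has natural values, so nothing is lost by rounding.\<close>
    define H where "H = nat \<lfloor>?h (2 * C * n)\<rfloor>"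
    have H: "?h (2 * C * n) = real H" by (simp add: H_def cayley_distance_def)
    have n1: "1 \<le> n" using n by (simp add: N0_def)
    have "C * (n + 1) \<le> 2 * C * n" using n1 by simp
    then have "?d w \<le> H" if "w \<in> L" "length w \<le> C * (n + 1)" for w
    proof -
      have "real (?d w) \<le> ?h (2 * C * n)"
        by (rule cayley_distance_ge[OF fin L that(1)])
          (use that(2) \<open>C * (n + 1) \<le> 2 * C * n\<close> in linarith)
      then show ?thesis unfolding H by simp
    qed
    then have bound: "n \<le> C * (C + 3 * H) ^ 3" by (rule C(2))
    \<comment> \<open>The additive constant is absorbed because a vanishing distance would bound \<open>n\<close>.\<close>
    have "H \<noteq> 0"
    proof
      assume "H = 0"
      then have "n \<le> C * C ^ 3" using bound by simp
      then show False using n by (simp add: N0_def)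
    qed
    then have "C + 3 * H \<le> (C + 3) * H" using C(1) by (simp add: algebra_simps)
    then have "(C + 3 * H) ^ 3 \<le> ((C + 3) * H) ^ 3" by (intro power_mono) auto
    then have "n \<le> C * ((C + 3) * H) ^ 3" using bound by (meson mult_le_mono2 order_trans)
    also have "\<dots> \<le> C ^ 3 * ((C + 3) * H) ^ 3"
      using C(1) self_le_power[of C 3] by (intro mult_le_mono1) auto
    also have "\<dots> = (C * (C + 3) * H) ^ 3" by (simp add: power_mult_distrib mult.assoc)
    finally have "real n \<le> real ((C * (C + 3) * H) ^ 3)" by (rule of_nat_mono)
    then have "root 3 (real n) \<le> root 3 (real (C * (C + 3) * H) ^ 3)"
      unfolding of_nat_power by simp
    also have "\<dots> = real (C * (C + 3) * H)" by (simp add: real_root_power_cancel)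
    finally show ?thesis unfolding H by simp
  qed
  then show "asymp_le 0 (\<lambda>n. root 3 (real n)) (cayley_distance_start L) ?h"
    unfolding asymp_le_def using C(1)
    by (intro exI[of _ "C * (C + 3)"] exI[of _ "2 * C"] exI[of _ N0]) (auto simp: N0_def)
qed auto

section \<open>Turing machines on two stacks\<close>

type_synonym 'q machine = "'q \<Rightarrow> nat option \<Rightarrow> ('q \<times> nat option \<times> head_move) option"

text \<open>
  The tape is split at the head: the cells to its left in reverse order, and the cells from
  the head on. Cells beyond the ends of both lists are blank.
\<close>

type_synonym 'q split_config = "'q \<times> nat option list \<times> nat option list"

definition cell :: "nat option list \<Rightarrow> nat option" where
  "cell xs = (case xs of [] \<Rightarrow> None | x # _ \<Rightarrow> x)"

lemma cell_simps [simp]: "cell [] = None" "cell (x # xs) = x"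
  by (simp_all add: cell_def)

fun split_step :: "'q machine \<Rightarrow> 'q split_config \<Rightarrow> 'q split_config option" where
  "split_step \<delta> (q, ls, rs) = map_option (\<lambda>(q', y, d). case d of
       MoveLeft \<Rightarrow> (q', tl ls, cell ls # y # tl rs)
     | Stay \<Rightarrow> (q', ls, y # tl rs)
     | MoveRight \<Rightarrow> (q', y # ls, tl rs)) (\<delta> q (cell rs))"

inductive runs :: "'q machine \<Rightarrow> nat \<Rightarrow> 'q split_config \<Rightarrow> 'q split_config \<Rightarrow> bool" for \<delta> where
  runs_refl: "runs \<delta> k c c"
| runs_step: "split_step \<delta> c = Some c' \<Longrightarrow> runs \<delta> k c' c'' \<Longrightarrow> runs \<delta> (Suc k) c c''"

lemma runs_mono: "runs \<delta> k c c' \<Longrightarrow> k \<le> k' \<Longrightarrow> runs \<delta> k' c c'"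
proof (induction arbitrary: k' rule: runs.induct)
  case (runs_step c c' k c'')
  then show ?case by (cases k') (auto intro: runs.runs_step)
qed (rule runs_refl)

lemma runs_trans: "runs \<delta> m c c' \<Longrightarrow> runs \<delta> n c' c'' \<Longrightarrow> runs \<delta> (m + n) c c''"
  by (induction rule: runs.induct) (auto intro: runs_mono runs_step)

lemma runs_one: "split_step \<delta> c = Some c' \<Longrightarrow> runs \<delta> 1 c c'"
  using runs_step[OF _ runs_refl, of \<delta> c c' 0] by simp

definition joined :: "int \<Rightarrow> nat option list \<Rightarrow> nat option list \<Rightarrow> int \<Rightarrow> nat option" where
  "joined h ls rs i =
     (if h \<le> i then nth_default None rs (nat (i - h)) else nth_default None ls (nat (h - 1 - i)))"

lemma nth_default_Cons: "nth_default None (x # xs) n = (if n = 0 then x else nth_default None xs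
    (n - 1))"
  by (cases n) auto

lemma nth_default_cell_tl: "nth_default None xs n = (if n = 0 then cell xs else nth_default None
    (tl xs) (n - 1))"
  by (cases xs; cases n) (auto simp: nth_default_def)

lemma joined_head: "joined h ls rs h = cell rs"
  by (simp add: joined_def nth_default_cell_tl[of rs])

lemma joined_write: "(joined h ls rs)(h := y) = joined h ls (y # tl rs)"
proof
  fix i
  show "((joined h ls rs)(h := y)) i = joined h ls (y # tl rs) i"
    by (simp add: joined_def nth_default_Cons nth_default_cell_tl[of rs "nat (i - h)"])
qed

lemma joined_right: "joined (h + 1) (y # ls) rs = joined h ls (y # rs)"
proof
  fix i
  consider "i < h" | "i = h" | "h < i" by linarith
  then show "joined (h + 1) (y # ls) rs i = joined h ls (y # rs) i"
  proof cases
    case 1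
    then have "nat (h + 1 - 1 - i) = Suc (nat (h - 1 - i))" by simp
    then show ?thesis using 1 by (simp add: joined_def nth_default_Cons)
  next
    case 3
    then have "nat (i - h) = Suc (nat (i - (h + 1)))" by simp
    then show ?thesis using 3 by (simp add: joined_def nth_default_Cons)
  qed (simp add: joined_def nth_default_Cons)
qed

lemma joined_left: "joined (h - 1) (tl ls) (cell ls # rs) = joined h ls rs"
proof (cases ls)
  case Nil
  have "joined (h - 1) [] (None # rs) i = joined h [] rs i" for i
  proof (cases "h \<le> i")
    case True
    then have "nat (i - (h - 1)) = Suc (nat (i - h))" by simp
    then show ?thesis using True by (simp add: joined_def nth_default_Cons)
  qed (simp add: joined_def nth_default_Cons)
  then show ?thesis using Nil by auto
next
  case (Cons y ls')
  then show ?thesis using joined_right[of "h - 1" y ls' rs] by simp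
qed

lemma word_tape_joined: "word_tape 0 w = joined 0 [] (map Some w)"
  by (rule ext) (auto simp: word_tape_def joined_def nth_default_def)

definition blank :: "nat option list \<Rightarrow> bool" where
  "blank xs \<longleftrightarrow> set xs \<subseteq> {None}"

lemma blank_simps [simp]: "blank []" "blank (x # xs) \<longleftrightarrow> x = None \<and> blank xs"
  by (auto simp: blank_def)

lemma blank_append [simp]: "blank (xs @ ys) \<longleftrightarrow> blank xs \<and> blank ys"
  by (auto simp: blank_def)

lemma blank_rev [simp]: "blank (rev xs) \<longleftrightarrow> blank xs"
  by (simp add: blank_def)

lemma blank_cell_tl: "blank xs \<Longrightarrow> cell xs = None \<and> blank (tl xs)"
  by (cases xs) auto

lemma blank_nth: "blank xs \<Longrightarrow> nth_default None xs n = None"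
proof (cases "n < length xs")
  case True
  moreover assume "blank xs"
  ultimately have "xs ! n = None" using nth_mem[OF True] unfolding blank_def by blast
  then show ?thesis by (simp add: nth_default_def)
qed (simp add: nth_default_def)

lemma joined_append:
  "joined h ls rs = joined (h - int (length ls)) [] (rev ls @ rs)"
proof (induction ls arbitrary: h rs)
  case (Cons y ls)
  show ?case
    using Cons.IH[of "h - 1" "y # rs"] joined_right[of "h - 1" y ls rs] by (simp add: algebra_simps)
qed simp

lemma joined_word:
  assumes "rev ls @ rs = as @ map Some v @ bs" "blank as" "blank bs"
  shows "joined h ls rs = word_tape (h - int (length ls) + int (length as)) v"
proof -
  let ?p = "h - int (length ls) + int (length as)"
  have bl: "nth_default None as n = None" "nth_default None bs n = None" for n
    using assms(2,3) by (auto intro: blank_nth)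
  have "joined h ls rs = joined (h - int (length ls)) [] (rev (rev as) @ map Some v @ bs)"
    using joined_append[of h ls rs] assms(1) by simp
  also have "\<dots> = joined ?p (rev as) (map Some v @ bs)"
    using joined_append[of ?p "rev as" "map Some v @ bs"] by simp
  also have "\<dots> = word_tape ?p v"
  proof
    fix i
    have "blank (rev as)" using assms(2) by simp
    then have "nth_default None (rev as) n = None" for n by (rule blank_nth)
    then show "joined ?p (rev as) (map Some v @ bs) i = word_tape ?p v i"
      by (auto simp: joined_def word_tape_def nth_default_append bl nth_default_def[of None
          "map Some v"])
  qed
  finally show ?thesis .
qed

text \<open>
  It is enough to bound the number of steps by a quadratic function and to describe the final tape
  up to blanks; states may come from any finite type.
\<close>

lemma polytime_computableI:
  fixes \<delta> :: "'q machine" and b :: nat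
  assumes fin: "finite (UNIV :: 'q set)" and "finite \<Gamma>" "\<Sigma> \<subseteq> \<Gamma>"
    and symbols: "\<And>q x q' y d. \<delta> q x = Some (q', y, d) \<Longrightarrow> x \<in> insert None (Some ` \<Gamma>) \<Longrightarrow>
      y \<in> insert None (Some ` \<Gamma>)"
    and f: "f \<in> lists \<Sigma> \<rightarrow> lists \<Sigma>"
    and run: "\<And>w. w \<in> lists \<Sigma> \<Longrightarrow> \<exists>q ls rs as bs. runs \<delta> (b * (length w + 1)\<^sup>2) (s, [], map Some w)
        (q, ls, rs) \<and>
      \<delta> q (cell rs) = None \<and> rev ls @ rs = as @ map Some (f w) @ bs \<and> blank as \<and> blank bs"
  shows "polytime_computable \<Sigma> f"
proof -
  obtain e :: "'q \<Rightarrow> nat" where e: "inj e"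
    using finite_imp_inj_to_nat_seg[OF fin] by blast
  define M where "M = \<lparr>tm_states = range e, tm_symbols = \<Gamma>, tm_start = e s,
    tm_trans = \<lambda>n x. map_option (\<lambda>(q', y, d). (e q', y, d)) (\<delta> (inv_into UNIV e n) x)\<rparr>"
  have inv: "inv_into UNIV e (e q) = q" for q using e by simp
  have wf: "wf_tm \<Sigma> M"
    unfolding wf_tm_def
  proof (intro conjI ballI allI impI)
    fix n x n' y d
    assume "n \<in> tm_states M" "x \<in> insert None (Some ` tm_symbols M)" "tm_trans M n x = Some
        (n', y, d)"
    then obtain q q' where q: "n' = e q'" "\<delta> q x = Some (q', y, d)" "x \<in> insert None (Some ` \<Gamma>)"
      by (auto simp: M_def inv)
    then show "n' \<in> tm_states M" by (simp add: M_def)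
    show "y \<in> insert None (Some ` tm_symbols M)" using symbols[OF q(2,3)] by (simp add: M_def)
  qed (use fin assms(2,3) in \<open>auto simp: M_def\<close>)
  have step: "\<exists>h'. tm_next M (e (fst c), h, joined h (fst (snd c)) (snd (snd c))) =
      Some (e (fst c'), h', joined h' (fst (snd c')) (snd (snd c')))"
    if st: "split_step \<delta> c = Some c'" for c c' h
  proof -
    obtain q ls rs where c: "c = (q, ls, rs)" by (cases c)
    obtain q' y d where d: "\<delta> q (cell rs) = Some (q', y, d)"
      using st unfolding c by (cases "\<delta> q (cell rs)") auto
    show ?thesis
      using st joined_left[of h ls "y # tl rs"] joined_right[of h y ls "tl rs"] unfolding c
      by (cases d) (auto simp: d M_def inv joined_head joined_write)
  qed
  have steps: "\<exists>m\<le>k. \<exists>h'. ((e (fst c), h, joined h (fst (snd c)) (snd (snd c))),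
      (e (fst c'), h', joined h' (fst (snd c')) (snd (snd c')))) \<in> {(c, c'). tm_next M c
          = Some c'} ^^ m"
    if "runs \<delta> k c c'" for k c c' h
    using that
  proof (induction arbitrary: h rule: runs.induct)
    case (runs_refl k c)
    then show ?case by (intro exI[of _ 0]) auto
  next
    case (runs_step c c' k c'')
    obtain h1 where "tm_next M (e (fst c), h, joined h (fst (snd c)) (snd (snd c))) =
      Some (e (fst c'), h1, joined h1 (fst (snd c')) (snd (snd c')))"
      using step[OF runs_step.hyps(1)] by blast
    moreover obtain m h' where "m \<le> k" "((e (fst c'), h1, joined h1 (fst (snd c')) (snd (snd c'))),
      (e (fst c''), h', joined h' (fst (snd c'')) (snd (snd c'')))) \<in> {(c, c'). tm_next M c
          = Some c'} ^^ m"
      using runs_step.IH[of h1] by blast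
    ultimately show ?case
      by (intro exI[of _ "Suc m"] conjI exI[of _ h'] relpow_Suc_I2) auto
  qed
  have "\<exists>k\<le>b * (length w + 1)\<^sup>2. tm_outputs M k w (f w)" if w: "w \<in> lists \<Sigma>" for w
  proof -
    obtain q ls rs as bs where r: "runs \<delta> (b * (length w + 1)\<^sup>2) (s, [], map Some w) (q, ls, rs)"
      "\<delta> q (cell rs) = None" "rev ls @ rs = as @ map Some (f w) @ bs" "blank as" "blank bs"
      using run[OF w] by blast
    obtain m h where m: "m \<le> b * (length w + 1)\<^sup>2"
      "((e s, 0, joined 0 [] (map Some w)), (e q, h, joined h ls rs)) \<in> {(c, c'). tm_next M c
          = Some c'} ^^ m"
      using steps[OF r(1), of 0] by auto
    have "tm_next M (e q, h, joined h ls rs) = None"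
      using r(2) by (simp add: M_def inv joined_head)
    then have "tm_outputs M m w (f w)"
      unfolding tm_outputs_def using m(2) unfolding joined_word[OF r(3-5)]
          word_tape_joined[symmetric]
      by (intro exI[of _ q] exI conjI) (auto simp: M_def)
    then show ?thesis using m(1) by blast
  qed
  moreover have "(\<lambda>n. real (b * (n + 1)\<^sup>2)) = (\<lambda>n. poly [:real b, 2 * real b, real b:] (real n))"
    by (auto simp: power2_eq_square algebra_simps)
  ultimately show ?thesis
    unfolding polytime_computable_def using wf f
    by (intro conjI exI[of _ M] exI[of _ "\<lambda>n. b * (n + 1)\<^sup>2"] exI[of _
        "[:real b, 2 * real b, real b:]"]) auto
qed

text \<open>
  The configuration with the head on the last cell of the left part, as it is after a move
  to the left.
\<close>

abbreviation left_config :: "'q \<Rightarrow> nat option list \<Rightarrow> nat option list \<Rightarrow> 'q split_config" where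
  "left_config q ls rs \<equiv> (q, tl ls, cell ls # rs)"

lemma sweep_right:
  assumes "\<And>c. c \<in> set u \<Longrightarrow> \<delta> q (Some c) = Some (q, Some c, MoveRight)"
  shows "runs \<delta> (length u) (q, ls, map Some u @ rs) (q, map Some (rev u) @ ls, rs)"
  using assms
proof (induction u arbitrary: ls)
  case (Cons c u)
  have "split_step \<delta> (q, ls, map Some (c # u) @ rs) = Some (q, Some c # ls, map Some u @ rs)"
    using Cons.prems by simp
  moreover have "runs \<delta> (length u) (q, Some c # ls, map Some u @ rs) (q, map Some (rev
      (c # u)) @ ls, rs)"
    using Cons.IH[of "Some c # ls"] Cons.prems by simp
  ultimately show ?case by (simp add: runs_step)
qed (simp add: runs_refl)

lemma sweep_left:
  assumes "\<And>c. c \<in> set u \<Longrightarrow> \<delta> q (Some c) = Some (q, Some (g c), MoveLeft)"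
  shows "runs \<delta> (length u) (left_config q (map Some (rev u) @ ls) rs)
    (left_config q ls (map Some (map g u) @ rs))"
  using assms
proof (induction u arbitrary: rs rule: rev_induct)
  case (snoc c u)
  have "split_step \<delta> (left_config q (map Some (rev (u @ [c])) @ ls) rs) =
      Some (left_config q (map Some (rev u) @ ls) (Some (g c) # rs))"
    using snoc.prems by simp
  moreover have "runs \<delta> (length u) (left_config q (map Some (rev u) @ ls) (Some (g c) # rs))
      (left_config q ls (map Some (map g (u @ [c])) @ rs))"
    using snoc.IH[of "Some (g c) # rs"] snoc.prems by simp
  ultimately show ?case by (simp add: runs_step)
qed (simp add: runs_refl)

section \<open>Normal forms \<open>y\<^sup>j x\<^sup>i z\<^sup>k\<close>\<close>

text \<open>The letters 0, ..., 5 are \<open>y, y\<^sup>-\<^sup>1, x, x\<^sup>-\<^sup>1, z, z\<^sup>-\<^sup>1\<close>: block number and sign.\<close>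

definition letter :: "nat \<Rightarrow> bool \<Rightarrow> nat" where
  "letter b s = 2 * b + (if s then 0 else 1)"

definition sgn_of :: "bool \<Rightarrow> int" where
  "sgn_of s = (if s then 1 else -1)"

definition power_word :: "nat \<Rightarrow> int \<Rightarrow> nat list" where
  "power_word b n = replicate (nat \<bar>n\<bar>) (letter b (n \<ge> 0))"

definition normal_word :: "int \<Rightarrow> int \<Rightarrow> int \<Rightarrow> nat list" where
  "normal_word i j k = power_word 0 j @ power_word 1 i @ power_word 2 k"

definition normal_words :: "nat list set" where
  "normal_words = {normal_word i j k | i j k. True}"

definition letter_elem :: "nat \<Rightarrow> nat" where
  "letter_elem c = (let e = (if even c then 1 else -1) in
     if c div 2 = 0 then triple 0 e 0 else if c div 2 = 1 then triple e 0 0 else triple 0 0 e)"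

definition spelled :: "nat list \<Rightarrow> nat" where
  "spelled w = word_value heisenberg (map letter_elem w)"

lemma normal_word_in: "normal_word i j k \<in> normal_words"
  by (auto simp: normal_words_def)

lemma letter_inject [simp]: "letter b s = letter b' s' \<longleftrightarrow> b = b' \<and> s = s'"
  by (auto simp: letter_def split: if_splits; presburger)

lemma letter_div [simp]: "letter b s div 2 = b"
  by (simp add: letter_def)

lemma ex_letter: "\<exists>s. c = letter (c div 2) s"
  by (intro exI[of _ "even c"]) (auto simp: letter_def)

lemma letter_less: "letter b s < 6 \<longleftrightarrow> b < 3"
  by (auto simp: letter_def)

lemma set_power_word: "c \<in> set (power_word b n) \<Longrightarrow> c div 2 = b \<and> c = letter b (n \<ge> 0)"
  by (auto simp: power_word_def)

lemma power_word_Nil [simp]: "power_word b 0 = []"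
  by (simp add: power_word_def)

lemma power_word_eq_Nil [simp]: "power_word b n = [] \<longleftrightarrow> n = 0"
  by (simp add: power_word_def)

lemma power_word_step:
  assumes "0 \<le> sgn_of s * n"
  shows "power_word b (n + sgn_of s) = letter b s # power_word b n"
    "power_word b (n + sgn_of s) = power_word b n @ [letter b s]"
proof -
  have len: "nat \<bar>n + sgn_of s\<bar> = Suc (nat \<bar>n\<bar>)" using assms by
      (auto simp: sgn_of_def split: if_splits)
  have sgn: "(n + sgn_of s \<ge> 0) = s" using assms by (auto simp: sgn_of_def split: if_splits)
  have rep: "replicate (nat \<bar>n\<bar>) (letter b (n \<ge> 0)) = replicate (nat \<bar>n\<bar>) (letter b s)"
    using assms by (auto simp: sgn_of_def split: if_splits)
  then show "power_word b (n + sgn_of s) = letter b s # power_word b n"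
    unfolding power_word_def len sgn rep by simp
  show "power_word b (n + sgn_of s) = power_word b n @ [letter b s]"
    unfolding power_word_def len sgn rep by (simp add: replicate_append_same)
qed

lemma power_word_cancel:
  assumes "\<not> 0 \<le> sgn_of s * n"
  shows "power_word b n = letter b (\<not> s) # power_word b (n + sgn_of s)"
    "power_word b n = power_word b (n + sgn_of s) @ [letter b (\<not> s)]"
  using power_word_step[of "\<not> s" "n + sgn_of s" b] assms
  by (auto simp: sgn_of_def split: if_splits)

lemma power_word_hd_last:
  assumes "0 \<le> sgn_of s * n" "n \<noteq> 0"
  shows "hd (power_word b n) = letter b s" "last (power_word b n) = letter b s"
  using assms by (auto simp: power_word_def sgn_of_def split: if_splits)

lemma spelled_append: "spelled (u @ v) = spelled u \<otimes>\<^bsub>heisenberg\<^esub> spelled v"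
  by (simp add: spelled_def)

lemma spelled_power_word:
  "spelled (power_word 0 n) = triple 0 n 0" "spelled (power_word 1 n) = triple n 0 0"
  "spelled (power_word 2 n) = triple 0 0 n"
proof -
  have "spelled (replicate m (letter 0 s)) = triple 0 (sgn_of s * int m) 0"
    "spelled (replicate m (letter 1 s)) = triple (sgn_of s * int m) 0 0"
    "spelled (replicate m (letter 2 s)) = triple 0 0 (sgn_of s * int m)" for m s
    by (induction m) (auto simp: spelled_def letter_elem_def letter_def sgn_of_def one_heisenberg
        algebra_simps)
  then show "spelled (power_word 0 n) = triple 0 n 0" "spelled (power_word 1 n) = triple n 0 0"
    "spelled (power_word 2 n) = triple 0 0 n"
    by (auto simp: power_word_def sgn_of_def)
qed

lemma spelled_normal_word: "spelled (normal_word i j k) = triple i j k"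
  by (simp only: normal_word_def spelled_append spelled_power_word mult_triple) simp

lemma bij_betw_spelled: "bij_betw spelled normal_words (carrier heisenberg)"
proof -
  have "inj_on spelled normal_words"
    by (auto simp: inj_on_def normal_words_def spelled_normal_word)
  moreover have "g \<in> spelled ` normal_words" for g
    using spelled_normal_word[of "xco g" "yco g" "zco g"]
    by (intro image_eqI[of _ _ "normal_word (xco g) (yco g) (zco g)"]) (auto simp: normal_words_def)
  ultimately show ?thesis by (auto simp: bij_betw_def)
qed

text \<open>Blocks occur in increasing order, and a block does not mix a letter with its inverse.\<close>

definition may_precede :: "nat \<Rightarrow> nat \<Rightarrow> bool" where
  "may_precede c d \<longleftrightarrow> c = d \<or> c div 2 < d div 2"

lemma normal_word_lists: "normal_word i j k \<in> lists {..<6}"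
  by (auto simp: normal_word_def power_word_def letter_less)

lemma successively_normal_word: "successively may_precede (normal_word i j k)"
proof -
  have "successively may_precede (replicate m c)" for m c
    by (induction m) (auto simp: may_precede_def successively_Cons)
  then have rep: "successively may_precede (power_word b n)" for b n
    by (simp add: power_word_def)
  have mp: "may_precede (last (power_word b n)) (hd (power_word b' n'))" if "n \<noteq> 0" "n' \<noteq> 0"
      "b < b'" for b n b' n'
    using that by (auto simp: power_word_def may_precede_def)
  show ?thesis
    using mp[of j i 0 1] mp[of j k 0 2] mp[of i k 1 2]
    by (auto simp: normal_word_def successively_append_iff rep hd_append)
qed

lemma normal_word_Cons:
  assumes "b < 3" "normal_word i j k \<noteq> [] \<longrightarrow> may_precede (letter b s) (hd (normal_word i j k))"
  shows "letter b s # normal_word i j k \<in> normal_words"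
proof -
  have hd: "hd (power_word b' n @ u) = letter b' (n \<ge> 0)" if "n \<noteq> 0" for b' n u
    using that by (simp add: power_word_def)
  have sgn: "0 \<le> sgn_of s * n" if "n \<noteq> 0 \<longrightarrow> (n \<ge> 0) = s" for n
    using that by (auto simp: sgn_of_def split: if_splits)
  consider "b = 0" | "b = 1" | "b = 2" using assms(1) by linarith
  then show ?thesis
  proof cases
    case 1
    then have "j \<noteq> 0 \<longrightarrow> (j \<ge> 0) = s"
      using assms(2) hd[of j 0] by (auto simp: normal_word_def may_precede_def)
    then have "letter b s # normal_word i j k = normal_word i (j + sgn_of s) k"
      using power_word_step(1)[OF sgn, of j 0] 1 by (simp add: normal_word_def)
    then show ?thesis by (auto simp: normal_words_def)
  next
    case 2
    have "j = 0"
    proof (rule ccontr)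
      assume "j \<noteq> 0"
      then show False
        using assms(2) hd[of j 0] 2 by (auto simp: normal_word_def may_precede_def)
    qed
    then have "i \<noteq> 0 \<longrightarrow> (i \<ge> 0) = s"
      using assms(2) hd[of i 1] 2 by (auto simp: normal_word_def may_precede_def)
    then have "letter b s # normal_word i j k = normal_word (i + sgn_of s) j k"
      using power_word_step(1)[OF sgn, of i 1] 2 \<open>j = 0\<close> by (simp add: normal_word_def)
    then show ?thesis by (auto simp: normal_words_def)
  next
    case 3
    have "j = 0"
    proof (rule ccontr)
      assume "j \<noteq> 0"
      then show False
        using assms(2) hd[of j 0] 3 by (auto simp: normal_word_def may_precede_def)
    qed
    moreover have "i = 0"
    proof (rule ccontr)
      assume "i \<noteq> 0"
      then show False
        using assms(2) hd[of i 1] 3 \<open>j = 0\<close> by (auto simp: normal_word_def may_precede_def)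
    qed
    ultimately have "k \<noteq> 0 \<longrightarrow> (k \<ge> 0) = s"
      using assms(2) hd[of k 2 "[]"] 3 by (auto simp: normal_word_def may_precede_def)
    then have "letter b s # normal_word i j k = normal_word i j (k + sgn_of s)"
      using power_word_step(1)[OF sgn, of k 2] 3 \<open>i = 0\<close> \<open>j = 0\<close> by (simp add: normal_word_def)
    then show ?thesis by (auto simp: normal_words_def)
  qed
qed

lemma normal_words_eq: "normal_words = {w \<in> lists {..<6}. successively may_precede w}"
proof (intro equalityI subsetI)
  show "w \<in> {w \<in> lists {..<6}. successively may_precede w}" if "w \<in> normal_words" for w
    using that normal_word_lists successively_normal_word by (auto simp: normal_words_def)
next
  show "w \<in> normal_words" if "w \<in> {w \<in> lists {..<6}. successively may_precede w}" for w
    using that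
  proof (induction w)
    case Nil
    have "[] = normal_word 0 0 0" by (simp add: normal_word_def)
    then show ?case unfolding normal_words_def by blast
  next
    case (Cons c w)
    then have "w \<in> normal_words" by (auto simp: successively_Cons)
    then obtain i j k where w: "w = normal_word i j k" by (auto simp: normal_words_def)
    obtain s where s: "c = letter (c div 2) s" using ex_letter by blast
    have c3: "c div 2 < 3" using Cons.prems by auto
    have "normal_word i j k \<noteq> [] \<longrightarrow> may_precede (letter (c div 2) s) (hd (normal_word i j k))"
      using Cons.prems w s by (auto simp: successively_Cons)
    from normal_word_Cons[OF c3 this] show ?case unfolding w s[symmetric] .
  qed
qed

lemma regular_normal_words: "regular_language {..<6} normal_words"
proof (rule regular_languageI)
  \<comment> \<open>The state is the last letter, 6 before the first letter, and 7 after a violation.\<close>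
  define step where "step = (\<lambda>q c. if q = 6 \<or> (q < 6 \<and> may_precede q c) then c else (7::nat))"
  have run: "foldl step 6 w = (if successively may_precede w then if w = [] then 6 else last w
      else 7)"
    if "w \<in> lists {..<6}" for w
    using that
  proof (induction w rule: rev_induct)
    case (snoc c w)
    have "w \<noteq> [] \<longrightarrow> last w < 6" using snoc.prems by auto
    then show ?case
      using snoc by (auto simp: step_def successively_append_iff)
  qed simp
  show "recognizable {..<6} (successively may_precede)"
  proof (rule recognizable_fold[where step = step and s = 6 and Q = "{..<8}" and F = "{..<7}"])
    show "successively may_precede w \<longleftrightarrow> foldl step 6 w \<in> {..<7}" if "w \<in> lists {..<6}" for w
    proof -
      have "w \<noteq> [] \<longrightarrow> last w < 6" using that by auto
      then show ?thesis using run[OF that] by auto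
    qed
  qed (auto simp: step_def)
qed (rule normal_words_eq)

section \<open>A machine that multiplies by \<open>x\<^sup>\<plusminus>\<^sup>1\<close>\<close>

definition zblock :: "nat \<Rightarrow> bool" where
  "zblock c \<longleftrightarrow> c = letter 2 True \<or> c = letter 2 False"

text \<open>
  A letter has to be inserted into or deleted from the middle of the word. In a normal form the
  letters behind it are all equal, so no shift is needed: one cell is overwritten, and
  one cell is added or erased at the end. On other words the function does whatever these moves
  amount to.
\<close>

definition times_x :: "bool \<Rightarrow> nat list \<Rightarrow> nat list" where
  "times_x s w = (let q = rev (takeWhile zblock (rev w)); p = rev (dropWhile zblock (rev w)) in
     if p \<noteq> [] \<and> last p = letter 1 (\<not> s)
     then butlast p @ (if q = [] then [] else hd q # butlast q)
     else p @ letter 1 s # (if q = [] then [] else tl q @ [hd q]))"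

datatype x_state = Find_End | Look "bool option" | Insert "bool option" | Append bool | To_End
    | Delete | Done

lemma finite_x_state: "finite (UNIV :: x_state set)"
proof -
  have "(UNIV :: x_state set) \<subseteq> {Find_End, To_End, Delete, Done} \<union> range Look \<union> range Insert \<union>
      range Append"
  proof
    fix q :: x_state
    show "q \<in> {Find_End, To_End, Delete, Done} \<union> range Look \<union> range Insert \<union> range Append"
      by (cases q) auto
  qed
  then show ?thesis by (rule finite_subset) simp
qed

text \<open>
  Walking back from the right end, \<open>Look\<close> remembers which \<open>z\<close>-letter was seen last: this letter
  fills the place of a deleted letter, and it is the one that is pushed to the right end by an
  inserted letter.
\<close>

fun x_machine :: "bool \<Rightarrow> x_state machine" where
  "x_machine s Find_End x = Some (case x of None \<Rightarrow> (Look None, None, MoveLeft) | Some c \<Rightarrow>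
      (Find_End, x, MoveRight))"
| "x_machine s (Look e) x = Some (
     if x = Some (letter 2 True) then (Look (Some True), x, MoveLeft)
     else if x = Some (letter 2 False) then (Look (Some False), x, MoveLeft)
     else if x = Some (letter 1 (\<not> s)) then
       (case e of None \<Rightarrow> (Done, None, Stay) | Some d \<Rightarrow> (To_End, Some (letter 2 d), MoveRight))
     else (Insert e, x, MoveRight))"
| "x_machine s (Insert e) x = Some (case e of
     None \<Rightarrow> (Done, Some (letter 1 s), Stay) | Some d \<Rightarrow> (Append d, Some (letter 1 s), MoveRight))"
| "x_machine s (Append d) x = Some (case x of None \<Rightarrow> (Done, Some (letter 2 d), Stay) | Some c \<Rightarrow>
    (Append d, x, MoveRight))"
| "x_machine s To_End x = Some (case x of None \<Rightarrow> (Delete, None, MoveLeft) | Some c \<Rightarrow>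
    (To_End, x, MoveRight))"
| "x_machine s Delete x = Some (Done, None, Stay)"
| "x_machine s Done x = None"

lemma zblock_split:
  obtains p q where "w = p @ q" "\<forall>c\<in>set q. zblock c" "p = [] \<or> \<not> zblock (last p)"
    "rev (takeWhile zblock (rev w)) = q" "rev (dropWhile zblock (rev w)) = p"
proof
  let ?p = "rev (dropWhile zblock (rev w))" and ?q = "rev (takeWhile zblock (rev w))"
  have "rev w = takeWhile zblock (rev w) @ dropWhile zblock (rev w)" by simp
  then show "w = ?p @ ?q" by (metis rev_append rev_rev_ident)
  show "\<forall>c\<in>set ?q. zblock c" by (auto dest: set_takeWhileD)
  show "?p = [] \<or> \<not> zblock (last ?p)"
    using hd_dropWhile[of zblock "rev w"] by (auto simp: last_rev)
qed simp_all

lemma times_x_eq: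
  assumes "\<forall>c\<in>set q. zblock c" "p = [] \<or> \<not> zblock (last p)"
  shows "times_x s (p @ q) = (if p \<noteq> [] \<and> last p = letter 1 (\<not> s)
     then butlast p @ (if q = [] then [] else hd q # butlast q)
     else p @ letter 1 s # (if q = [] then [] else tl q @ [hd q]))"
proof -
  have "takeWhile zblock (rev p) = []" "dropWhile zblock (rev p) = rev p"
    using assms(2) by (cases p rule: rev_cases; simp)+
  then have "takeWhile zblock (rev (p @ q)) = rev q" "dropWhile zblock (rev (p @ q)) = rev p"
    using assms(1) by (simp_all add: takeWhile_append dropWhile_append)
  then show ?thesis by (simp add: times_x_def)
qed

definition seen :: "bool option \<Rightarrow> nat list \<Rightarrow> bool option" where
  "seen e q = (if q = [] then e else Some (hd q = letter 2 True))"

lemma look_back: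
  assumes "\<forall>c\<in>set q. zblock c"
  shows "runs (x_machine s) (length q) (left_config (Look e) (map Some (rev q) @ ls) rs)
    (left_config (Look (seen e q)) ls (map Some q @ rs))"
  using assms
proof (induction q arbitrary: e rs rule: rev_induct)
  case (snoc c q)
  have c: "c = letter 2 True \<or> c = letter 2 False" using snoc.prems by (simp add: zblock_def)
  let ?e = "Some (c = letter 2 True)"
  have "split_step (x_machine s) (left_config (Look e) (map Some (rev (q @ [c])) @ ls) rs) =
      Some (left_config (Look ?e) (map Some (rev q) @ ls) (Some c # rs))"
    using c by auto
  moreover have "runs (x_machine s) (length q) (left_config (Look ?e) (map Some (rev q) @ ls)
      (Some c # rs))
      (left_config (Look (seen ?e q)) ls (map Some (q @ [c]) @ rs))"
    using snoc.IH[of ?e "Some c # rs"] snoc.prems by simp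
  moreover have "seen ?e q = seen e (q @ [c])" by (cases q) (auto simp: seen_def)
  ultimately show ?case by (simp add: runs_step)
qed (simp add: runs_refl seen_def)

lemma seen_letter:
  assumes "\<forall>c\<in>set q. zblock c" "q \<noteq> []"
  shows "seen None q = Some (hd q = letter 2 True)" "letter 2 (hd q = letter 2 True) = hd q"
  using assms by (cases q; auto simp: seen_def zblock_def)+

lemma x_machine_run:
  assumes "\<forall>c\<in>set q. zblock c" "p = [] \<or> \<not> zblock (last p)"
  shows "\<exists>ls rs as bs. runs (x_machine s) (6 * (length (p @ q) + 1)) (Find_End, [], map Some
      (p @ q)) (Done, ls, rs) \<and>
    rev ls @ rs = as @ map Some (times_x s (p @ q)) @ bs \<and> blank as \<and> blank bs"
proof -
  let ?M = "x_machine s"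
  have 1: "runs ?M (length (p @ q)) (Find_End, [], map Some (p @ q)) (Find_End, map Some
      (rev q) @ map Some (rev p), [])"
    using sweep_right[of "p @ q" ?M Find_End "[]" "[]"] by simp
  have 2: "runs ?M 1 (Find_End, map Some (rev q) @ map Some (rev p), [])
      (left_config (Look None) (map Some (rev q) @ map Some (rev p)) [None])"
    by (rule runs_one) simp
  have 3: "runs ?M (length q) (left_config (Look None) (map Some (rev q) @ map Some (rev p)) [None])
      (left_config (Look (seen None q)) (map Some (rev p)) (map Some q @ [None]))"
    by (rule look_back[OF assms(1)])
  note start = runs_trans[OF runs_trans[OF 1 2] 3]
  have finish: ?thesis
    if "runs ?M (3 * length q + 3) (left_config (Look (seen None q)) (map Some (rev p))
        (map Some q @ [None])) (Done, ls, rs)"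
      "rev ls @ rs = as @ map Some (times_x s (p @ q)) @ bs" "blank as" "blank bs" for ls rs as bs
    using runs_mono[OF runs_trans[OF start that(1)], of "6 * (length (p @ q) + 1)"] that(2-4)
        by auto
  show ?thesis
  proof (cases "p \<noteq> [] \<and> last p = letter 1 (\<not> s)")
    case True
    then obtain p' where p: "p = p' @ [letter 1 (\<not> s)]" by (metis append_butlast_last_id)
    show ?thesis
    proof (cases "q = []")
      case True
      have "runs ?M 1 (left_config (Look (seen None q)) (map Some (rev p)) (map Some q @ [None]))
          (Done, map Some (rev p'), [None, None])"
        by (rule runs_one) (simp add: p True seen_def)
      then have "runs ?M (3 * length q + 3) (left_config (Look (seen None q)) (map Some (rev p))
          (map Some q @ [None]))
          (Done, map Some (rev p'), [None, None])"
        by (rule runs_mono) simp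
      then show ?thesis
        by (rule finish[where as = "[]" and bs = "[None, None]"])
          (simp_all only: times_x_eq[OF assms], simp_all add: p True rev_map)
    next
      case False
      then obtain r c where r: "q = r @ [c]" by (metis append_butlast_last_id)
      let ?ls = "Some (hd q) # map Some (rev p')"
      have 1: "runs ?M 1 (left_config (Look (seen None q)) (map Some (rev p)) (map Some q @ [None]))
          (To_End, ?ls, map Some q @ [None])"
        by (rule runs_one) (simp add: p seen_letter[OF assms(1) False])
      have 2: "runs ?M (length q) (To_End, ?ls, map Some q @ [None]) (To_End, map Some
          (rev q) @ ?ls, [None])"
        by (rule sweep_right) simp
      have 3: "runs ?M 1 (To_End, map Some (rev q) @ ?ls, [None]) (left_config Delete (map Some
          (rev q) @ ?ls) [None])"
        by (rule runs_one) simp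
      have 4: "runs ?M 1 (left_config Delete (map Some (rev q) @ ?ls) [None]) (Done, map Some
          (rev r) @ ?ls, [None, None])"
        by (rule runs_one) (simp add: r)
      from runs_trans[OF runs_trans[OF runs_trans[OF 1 2] 3] 4]
      have "runs ?M (3 * length q + 3) (left_config (Look (seen None q)) (map Some (rev p))
          (map Some q @ [None]))
          (Done, map Some (rev r) @ ?ls, [None, None])"
        by (rule runs_mono) simp
      then show ?thesis
        by (rule finish[where as = "[]" and bs = "[None, None]"])
          (simp_all only: times_x_eq[OF assms], simp_all add: p r rev_map)
    qed
  next
    case False
    define lb where "lb = (if p = [] then [None] else [] :: nat option list)"
    have lb: "blank lb" by (simp add: lb_def)
    have "cell (map Some (rev p)) \<noteq> Some (letter 1 (\<not> s))" "cell (map Some (rev p)) \<noteq> Some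
        (letter 2 b)"
      "cell (map Some (rev p)) # tl (map Some (rev p)) = map Some (rev p) @ lb" for b
      using False assms(2) by (cases p rule: rev_cases; cases b; auto simp: zblock_def lb_def)+
    then have ins: "runs ?M 1 (left_config (Look (seen None q)) (map Some (rev p))
        (map Some q @ [None]))
        (Insert (seen None q), map Some (rev p) @ lb, map Some q @ [None])"
      by (intro runs_one) simp
    show ?thesis
    proof (cases q)
      case Nil
      have "runs ?M 1 (Insert (seen None q), map Some (rev p) @ lb, map Some q @ [None])
          (Done, map Some (rev p) @ lb, [Some (letter 1 s)])"
        by (rule runs_one) (simp add: Nil seen_def)
      from runs_trans[OF ins this]
      have "runs ?M (3 * length q + 3) (left_config (Look (seen None q)) (map Some (rev p))
          (map Some q @ [None]))
          (Done, map Some (rev p) @ lb, [Some (letter 1 s)])"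
        by (rule runs_mono) simp
      then show ?thesis
        by (rule finish[where as = "rev lb" and bs = "[]"])
          (simp_all only: times_x_eq[OF assms] if_not_P[OF False], simp_all add: Nil rev_map lb)
    next
      case (Cons c r)
      let ?d = "hd q = letter 2 True" and ?ls = "Some (letter 1 s) # map Some (rev p) @ lb"
      have 1: "runs ?M 1 (Insert (seen None q), map Some (rev p) @ lb, map Some q @ [None])
          (Append ?d, ?ls, map Some r @ [None])"
        by (rule runs_one) (use seen_letter(1)[OF assms(1)] Cons in simp)
      have 2: "runs ?M (length r) (Append ?d, ?ls, map Some r @ [None]) (Append ?d, map Some
          (rev r) @ ?ls, [None])"
        by (rule sweep_right) simp
      have 3: "runs ?M 1 (Append ?d, map Some (rev r) @ ?ls, [None]) (Done, map Some
          (rev r) @ ?ls, [Some (hd q)])"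
        by (rule runs_one) (use seen_letter(2)[OF assms(1)] Cons in simp)
      from runs_trans[OF runs_trans[OF runs_trans[OF ins 1] 2] 3]
      have "runs ?M (3 * length q + 3) (left_config (Look (seen None q)) (map Some (rev p))
          (map Some q @ [None]))
          (Done, map Some (rev r) @ ?ls, [Some (hd q)])"
        by (rule runs_mono) (simp add: Cons)
      then show ?thesis
        by (rule finish[where as = "rev lb" and bs = "[]"])
          (simp_all only: times_x_eq[OF assms] if_not_P[OF False], simp_all add: Cons rev_map lb)
    qed
  qed
qed

lemma polytime_times_x: "polytime_computable {..<6} (times_x s)"
proof (rule polytime_computableI[where \<delta> = "x_machine s" and \<Gamma> = "{..<6}" and s = Find_End and b
    = 6])
  show "finite (UNIV :: x_state set)" by (rule finite_x_state)
  show "times_x s \<in> lists {..<6} \<rightarrow> lists {..<6}"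
  proof
    fix w :: "nat list"
    assume w: "w \<in> lists {..<6}"
    obtain p q where s: "w = p @ q" "\<forall>c\<in>set q. zblock c" "p = [] \<or> \<not> zblock (last p)"
      by (rule zblock_split)
    have "set (butlast p) \<subseteq> {..<6}" "set (butlast q) \<subseteq> {..<6}" "set (tl q) \<subseteq> {..<6}" "q \<noteq> []
        \<longrightarrow> hd q < 6"
      using w s(1) by (cases q; auto dest: in_set_butlastD)+
    then show "times_x s w \<in> lists {..<6}"
      unfolding s(1) times_x_eq[OF s(2,3)] using w s(1) by (auto simp: letter_less)
  qed
next
  show "y \<in> insert None (Some ` {..<6})"
    if "x_machine s q x = Some (q', y, d)" "x \<in> insert None (Some ` {..<6})" for q x q' y d
    using that by (cases q) (auto split: if_splits option.splits simp: letter_less)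
next
  fix w :: "nat list"
  obtain p q where split: "w = p @ q" "\<forall>c\<in>set q. zblock c" "p = [] \<or> \<not> zblock (last p)"
    by (rule zblock_split)
  obtain ls rs as bs where r: "runs (x_machine s) (6 * (length w + 1)) (Find_End, [], map Some w)
      (Done, ls, rs)"
    "rev ls @ rs = as @ map Some (times_x s w) @ bs" "blank as" "blank bs"
    using x_machine_run[OF split(2,3)] unfolding split(1)[symmetric] by blast
  have "6 * (length w + 1) \<le> 6 * (length w + 1)\<^sup>2" by (simp add: power2_eq_square)
  from runs_mono[OF r(1) this] r(2-4)
  show "\<exists>q ls rs as bs. runs (x_machine s) (6 * (length w + 1)\<^sup>2) (Find_End, [], map Some w)
      (q, ls, rs) \<and>
      x_machine s q (cell rs) = None \<and> rev ls @ rs = as @ map Some (times_x s w) @ bs \<and> blank as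
          \<and> blank bs"
    by (intro exI[of _ Done] exI[of _ ls] exI[of _ rs] exI[of _ as] exI[of _ bs]) simp
qed simp_all

lemma times_x_normal_word: "times_x s (normal_word i j k) = normal_word (i + sgn_of s) j k"
proof -
  let ?p = "power_word 0 j @ power_word 1 i" and ?q = "power_word 2 k"
  have q: "\<forall>c\<in>set ?q. zblock c"
    using set_power_word[of _ 2 k] by (auto simp: zblock_def) metis
  have p: "?p = [] \<or> \<not> zblock (last ?p)"
  proof (cases "?p = []")
    case False
    then have "last ?p \<in> set ?p" by (rule last_in_set)
    then have "last ?p div 2 \<noteq> 2" using set_power_word[of _ 0 j] set_power_word[of _ 1 i] by auto
    then show ?thesis by (auto simp: zblock_def)
  qed simp
  have rot: "(if ?q = [] then [] else hd ?q # butlast ?q) = ?q" "(if ?q = [] then []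
      else tl ?q @ [hd ?q]) = ?q"
  proof -
    have snoc: "replicate (Suc m) c = replicate m c @ [c]" for m and c :: nat
      by (simp add: replicate_append_same)
    then have "butlast (replicate (Suc m) c) = replicate m c" for m and c :: nat
      by (metis butlast_snoc)
    then have 1: "(if replicate m c = [] then [] else hd (replicate m c) # butlast
        (replicate m c)) = replicate m c"
      for m and c :: nat by (cases m) (simp_all del: butlast.simps)
    have 2: "(if replicate m c = [] then [] else tl (replicate m c) @ [hd (replicate m c)])
        = replicate m c"
      for m and c :: nat by (cases m) (simp_all add: replicate_append_same)
    show "(if ?q = [] then [] else hd ?q # butlast ?q) = ?q" "(if ?q = [] then []
        else tl ?q @ [hd ?q]) = ?q"
      unfolding power_word_def by (rule 1, rule 2)
  qed
  have eq: "times_x s (normal_word i j k) = (if ?p \<noteq> [] \<and> last ?p = letter 1 (\<not> s)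
     then butlast ?p @ ?q else ?p @ letter 1 s # ?q)"
    using times_x_eq[OF q p, of s] unfolding rot normal_word_def by simp
  show ?thesis
  proof (cases "0 \<le> sgn_of s * i")
    case True
    have "\<not> (?p \<noteq> [] \<and> last ?p = letter 1 (\<not> s))"
    proof (cases "i = 0")
      case i: True
      have "last (power_word 0 j) \<noteq> letter 1 (\<not> s)" if "j \<noteq> 0" using that by
          (simp add: power_word_def)
      then show ?thesis by (cases "j = 0") (simp_all add: i)
    next
      case False
      then show ?thesis using power_word_hd_last(2)[OF True, of 1] by simp
    qed
    then show ?thesis
      unfolding eq if_not_P[OF \<open>\<not> _\<close>] using power_word_step(2)[OF True, of 1] by
          (simp add: normal_word_def)
  next
    case False
    then show ?thesis
      unfolding eq using power_word_cancel(2)[OF False, of 1] by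
          (simp add: normal_word_def butlast_append)
  qed
qed

section \<open>A machine that multiplies by \<open>y\<^sup>\<plusminus>\<^sup>1\<close>\<close>

definition push_z :: "bool \<Rightarrow> nat list \<Rightarrow> nat list" where
  "push_z d w = (if w \<noteq> [] \<and> last w = letter 2 (\<not> d) then butlast w else w @ [letter 2 d])"

definition put_y :: "bool \<Rightarrow> nat list \<Rightarrow> nat list" where
  "put_y s w = (if w \<noteq> [] \<and> hd w = letter 0 (\<not> s) then tl w else letter 0 s # w)"

definition xblock :: "nat \<Rightarrow> bool" where
  "xblock c \<longleftrightarrow> c = letter 1 True \<or> c = letter 1 False"

definition pushes :: "bool \<Rightarrow> nat list \<Rightarrow> nat list \<Rightarrow> nat list" where
  "pushes s cs w = foldl (\<lambda>w c. push_z (s = (c = letter 1 True)) w) w cs"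

text \<open>
  Moving \<open>y\<^sup>s\<close> to the front across \<open>x\<^sup>i\<close> leaves \<open>z\<^sup>s\<^sup>i\<close>, that is, one letter \<open>z\<^sup>\<plusminus>\<^sup>1\<close> at the
  right end for each letter of the block of \<open>x\<close>.
\<close>

definition times_y :: "bool \<Rightarrow> nat list \<Rightarrow> nat list" where
  "times_y s w = pushes s (filter xblock w) (put_y s w)"

text \<open>The letters 6 and 7 are the letters 2 and 3 that have been accounted for.\<close>

definition mark :: "nat \<Rightarrow> nat" where
  "mark c = (if xblock c then c + 4 else c)"

definition unmark :: "nat \<Rightarrow> nat" where
  "unmark c = (if c = 6 \<or> c = 7 then c - 4 else c)"

datatype y_state = Start | Put | Scan | Push bool | Last bool | Add bool | Back | Restore

lemma finite_y_state: "finite (UNIV :: y_state set)"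
proof -
  have "(UNIV :: y_state set) \<subseteq> {Start, Put, Scan, Back, Restore} \<union> range Push \<union> range Last \<union>
      range Add"
  proof
    fix q :: y_state
    show "q \<in> {Start, Put, Scan, Back, Restore} \<union> range Push \<union> range Last \<union> range Add"
      by (cases q) auto
  qed
  then show ?thesis by (rule finite_subset) simp
qed

text \<open>
  \<open>Start\<close> and \<open>Put\<close> adjust the left end. Then \<open>Scan\<close> marks the next letter \<open>x\<^sup>\<plusminus>\<^sup>1\<close>, and
  \<open>Push\<close>, \<open>Last\<close>, \<open>Add\<close> cancel or append one letter \<open>z\<^sup>\<plusminus>\<^sup>1\<close> at the right end. \<open>Back\<close> returns to
  the rightmost mark, which is the letter that was marked last. When no unmarked letter is left,
  \<open>Restore\<close> erases the marks.
\<close>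

fun y_machine :: "bool \<Rightarrow> y_state machine" where
  "y_machine s Start x = Some (if x = Some (letter 0 (\<not> s)) then (Scan, None, MoveRight) else
      (Put, x, MoveLeft))"
| "y_machine s Put x = Some (Scan, Some (letter 0 s), MoveRight)"
| "y_machine s Scan x = Some (case x of None \<Rightarrow> (Restore, None, MoveLeft)
     | Some c \<Rightarrow> if xblock c then (Push (s = (c = letter 1 True)), Some (mark c), MoveRight) else
         (Scan, x, MoveRight))"
| "y_machine s (Push d) x = Some (case x of None \<Rightarrow> (Last d, None, MoveLeft) | Some c \<Rightarrow>
    (Push d, x, MoveRight))"
| "y_machine s (Last d) x = Some (if x = Some (letter 2 (\<not> d)) then (Back, None, MoveLeft) else
    (Add d, x, MoveRight))"
| "y_machine s (Add d) x = Some (Back, Some (letter 2 d), MoveLeft)"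
| "y_machine s Back x = (case x of None \<Rightarrow> None
     | Some c \<Rightarrow> Some (if c = 6 \<or> c = 7 then (Scan, x, MoveRight) else (Back, x, MoveLeft)))"
| "y_machine s Restore x = map_option (\<lambda>c. (Restore, Some (unmark c), MoveLeft)) x"

lemma xblock_iff: "xblock c \<longleftrightarrow> c = 2 \<or> c = 3"
  by (auto simp: xblock_def letter_def)

lemma unmark_mark: "c < 6 \<Longrightarrow> unmark (mark c) = c"
  by (auto simp: unmark_def mark_def xblock_iff)

lemma push_z_append:
  assumes "u \<noteq> []" "xblock (last u)"
  shows "push_z d (u @ v) = u @ push_z d v"
  using assms by (cases v rule: rev_cases) (auto simp: push_z_def butlast_append xblock_def)

lemma push_z_lists: "w \<in> lists {..<6} \<Longrightarrow> push_z d w \<in> lists {..<6}"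
  by (auto simp: push_z_def letter_less dest: in_set_butlastD)

lemma length_push_z: "length (push_z d w) \<le> length w + 1"
  by (auto simp: push_z_def)

lemma filter_push_z: "filter xblock (push_z d w) = filter xblock w"
  by (cases w rule: rev_cases) (auto simp: push_z_def xblock_def)

lemma pushes_simps [simp]:
  "pushes s [] w = w" "pushes s (c # cs) w = pushes s cs (push_z (s = (c = letter 1 True)) w)"
  by (simp_all add: pushes_def)

lemma pushes_lists: "w \<in> lists {..<6} \<Longrightarrow> pushes s cs w \<in> lists {..<6}"
  by (induction cs arbitrary: w) (simp_all add: push_z_lists del: in_lists_conv_set)

lemma length_pushes: "length (pushes s cs w) \<le> length w + length cs"
proof (induction cs arbitrary: w)
  case (Cons c cs)
  show ?case
    using Cons.IH[of "push_z (s = (c = letter 1 True)) w"]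
      length_push_z[of "s = (c = letter 1 True)" w] by simp
qed simp

text \<open>
  One round trip: mark a letter \<open>x\<^sup>\<plusminus>\<^sup>1\<close>, adjust the right end, and come back to the mark. The part
  behind the mark does not get longer than it was together with the marked letter.
\<close>

lemma round_trip:
  fixes s :: bool
  assumes c: "xblock c" and r: "r \<in> lists {..<6}" and rb: "blank rb"
  defines "d \<equiv> (s = (c = letter 1 True))"
  shows "\<exists>rb'. blank rb' \<and> runs (y_machine s) (2 * length r + 5)
    (Scan, ls, map Some (c # r) @ rb) (Scan, Some (mark c) # ls, map Some (push_z d r) @ rb')"
proof -
  let ?M = "y_machine s" and ?ls = "Some (mark c) # ls"
  have m: "mark c = 6 \<or> mark c = 7" using c by (auto simp: mark_def xblock_iff)
  have 1: "runs ?M 1 (Scan, ls, map Some (c # r) @ rb) (Push d, ?ls, map Some r @ rb)"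
    by (rule runs_one) (simp add: c d_def)
  have 2: "runs ?M (length r) (Push d, ?ls, map Some r @ rb) (Push d, map Some (rev r) @ ?ls, rb)"
    by (rule sweep_right) simp
  have 3: "runs ?M 1 (Push d, map Some (rev r) @ ?ls, rb) (left_config (Last d) (map Some
      (rev r) @ ?ls) (None # tl rb))"
    by (rule runs_one) (use blank_cell_tl[OF rb] in simp)
  note start = runs_trans[OF runs_trans[OF 1 2] 3]
  have return: "runs ?M (length u) (left_config Back (map Some (rev u) @ ?ls) bs)
      (left_config Back ?ls (map Some (map (\<lambda>c. c) u) @ bs))"
    if u: "u \<in> lists {..<6}" for u bs
    by (rule sweep_left) (use u in auto)
  have turn: "runs ?M 1 (left_config Back ?ls bs) (Scan, ?ls, bs)" for bs
    by (rule runs_one) (use m in auto)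
  show ?thesis
  proof (cases "r \<noteq> [] \<and> last r = letter 2 (\<not> d)")
    case True
    then obtain u where u: "r = u @ [letter 2 (\<not> d)]" by (metis append_butlast_last_id)
    have 4: "runs ?M 1 (left_config (Last d) (map Some (rev r) @ ?ls) (None # tl rb))
        (left_config Back (map Some (rev u) @ ?ls) (None # None # tl rb))"
      by (rule runs_one) (simp add: u)
    have "u \<in> lists {..<6}" using r u by simp
    note chain = runs_trans[OF runs_trans[OF runs_trans[OF start 4] return[OF this]] turn]
    have "push_z d r = u" by (simp add: push_z_def u)
    then have "runs ?M (2 * length r + 5) (Scan, ls, map Some (c # r) @ rb)
        (Scan, ?ls, map Some (push_z d r) @ None # None # tl rb)"
      using runs_mono[OF chain, of "2 * length r + 5"] by (simp add: u)
    then show ?thesis using blank_cell_tl[OF rb] by (intro exI[of _ "None # None # tl rb"]) simp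
  next
    case False
    have "cell (map Some (rev r) @ ?ls) \<noteq> Some (letter 2 (\<not> d))"
      using False m by (cases r rule: rev_cases; cases d; auto simp: letter_def)
    moreover have "cell (map Some (rev r) @ ?ls) # tl (map Some (rev r) @ ?ls) = map Some
        (rev r) @ ?ls"
      by (cases r rule: rev_cases) auto
    ultimately have 4: "runs ?M 1 (left_config (Last d) (map Some (rev r) @ ?ls) (None # tl rb))
        (Add d, map Some (rev r) @ ?ls, None # tl rb)"
      by (intro runs_one) simp
    have 5: "runs ?M 1 (Add d, map Some (rev r) @ ?ls, None # tl rb)
        (left_config Back (map Some (rev r) @ ?ls) (Some (letter 2 d) # tl rb))"
      by (rule runs_one) simp
    note chain = runs_trans[OF runs_trans[OF runs_trans[OF runs_trans[OF start 4] 5] return[OF r]]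
        turn]
    have "runs ?M (2 * length r + 5) (Scan, ls, map Some (c # r) @ rb)
        (Scan, ?ls, map Some (push_z d r) @ tl rb)"
      using runs_mono[OF chain, of "2 * length r + 5"] False by (auto simp: push_z_def)
    then show ?thesis using blank_cell_tl[OF rb] by blast
  qed
qed

text \<open>
  The word \<open>a\<close> has been scanned and carries marks, \<open>b\<close> has not. A round trip does not lengthen
  the unscanned part, so \<open>n\<close> bounds it throughout.
\<close>

lemma scan_loop:
  assumes "a \<in> lists {..<6}" "b \<in> lists {..<6}" "blank rb" "length b \<le> n"
  shows "\<exists>rb'. blank rb' \<and> runs (y_machine s) ((length (filter xblock b) + 1) * (3 * n + 5))
    (Scan, map Some (rev (map mark a)) @ lb, map Some b @ rb)
    (Scan, map Some (rev (map mark (pushes s (filter xblock b) (a @ b)))) @ lb, rb')"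
  using assms
proof (induction "length (filter xblock b)" arbitrary: a b rb)
  case 0
  then have no: "\<not> xblock c" if "c \<in> set b" for c using that by (simp add: filter_empty_conv)
  then have "map mark b = b" by (intro map_idI) (simp add: mark_def)
  moreover have "runs (y_machine s) (length b) (Scan, map Some (rev
      (map mark a)) @ lb, map Some b @ rb)
      (Scan, map Some (rev b) @ map Some (rev (map mark a)) @ lb, rb)"
    by (rule sweep_right) (use no in simp)
  ultimately have "runs (y_machine s) (length b) (Scan, map Some (rev
      (map mark a)) @ lb, map Some b @ rb)
      (Scan, map Some (rev (map mark (a @ b))) @ lb, rb)"
    by simp
  then have "runs (y_machine s) ((length (filter xblock b) + 1) * (3 * n + 5)) (Scan, map Some
      (rev (map mark a)) @ lb, map Some b @ rb)
      (Scan, map Some (rev (map mark (a @ b))) @ lb, rb)"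
    by (rule runs_mono) (use 0 in simp)
  moreover have "pushes s (filter xblock b) (a @ b) = a @ b" using 0 by simp
  ultimately show ?case using \<open>blank rb\<close> by auto
next
  case (Suc k)
  then have "filter xblock b \<noteq> []" by auto
  then obtain c cs where "filter xblock b = c # cs" by (cases "filter xblock b") auto
  then obtain p r where b: "b = p @ c # r" and p: "\<forall>c\<in>set p. \<not> xblock c" and c: "xblock c"
    and cs: "cs = filter xblock r"
    by (auto simp: filter_eq_Cons_iff)
  let ?d = "s = (c = letter 1 True)" and ?M = "y_machine s"
  have lists: "p \<in> lists {..<6}" "c < 6" "r \<in> lists {..<6}" using Suc.prems(2) b by auto
  have "map mark p = p" using p by (intro map_idI) (simp add: mark_def)
  then have 1: "runs ?M (length p) (Scan, map Some (rev (map mark a)) @ lb, map Some b @ rb)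
      (Scan, map Some (rev (map mark (a @ p))) @ lb, map Some (c # r) @ rb)"
    using sweep_right[of p ?M Scan "map Some (rev (map mark a)) @ lb" "map Some (c # r) @ rb"] p b
        by simp
  obtain rb1 where rb1: "blank rb1" and 2: "runs ?M (2 * length r + 5)
      (Scan, map Some (rev (map mark (a @ p))) @ lb, map Some (c # r) @ rb)
      (Scan, Some (mark c) # map Some (rev (map mark (a @ p))) @ lb, map Some (push_z ?d r) @ rb1)"
    using round_trip[OF c lists(3) Suc.prems(3)] by blast
  have len: "length (push_z ?d r) \<le> n" using length_push_z[of ?d r] Suc.prems(4) b by simp
  have fil: "filter xblock (push_z ?d r) = filter xblock r" by (rule filter_push_z)
  have "k = length (filter xblock (push_z ?d r))" unfolding fil using Suc.hyps(2) b p c by simp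
  moreover have "a @ p @ [c] \<in> lists {..<6}" using Suc.prems(1) lists by auto
  ultimately obtain rb2 where rb2: "blank rb2" and 3: "runs ?M ((length (filter xblock r) + 1) *
      (3 * n + 5))
      (Scan, map Some (rev (map mark (a @ p @ [c]))) @ lb, map Some (push_z ?d r) @ rb1)
      (Scan, map Some (rev (map mark (pushes s (filter xblock r)
          ((a @ p @ [c]) @ push_z ?d r)))) @ lb, rb2)"
    using Suc.hyps(1)[OF _ _ push_z_lists[OF lists(3)] rb1 len, of "a @ p @ [c]"] unfolding fil
        by blast
  have "(a @ p @ [c]) @ push_z ?d r = push_z ?d (a @ b)"
    using push_z_append[of "a @ p @ [c]" ?d r] c b by simp
  then have eq: "pushes s (filter xblock r) ((a @ p @ [c]) @ push_z ?d r) = pushes s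
      (filter xblock b) (a @ b)"
    using b p c by simp
  have 3: "runs ?M ((length (filter xblock r) + 1) * (3 * n + 5))
      (Scan, Some (mark c) # map Some (rev (map mark (a @ p))) @ lb, map Some (push_z ?d r) @ rb1)
      (Scan, map Some (rev (map mark (pushes s (filter xblock b) (a @ b)))) @ lb, rb2)"
    using 3 unfolding eq by simp
  have "length p + (2 * length r + 5) + (length (filter xblock r) + 1) * (3 * n + 5)
      \<le> (length (filter xblock b) + 1) * (3 * n + 5)"
    using Suc.prems(4) b p c by simp
  from runs_mono[OF runs_trans[OF runs_trans[OF 1 2] 3] this] rb2 show ?case by blast
qed

lemma put_y_run:
  "\<exists>a b lb rb. a @ b = put_y s w \<and> filter xblock a = [] \<and> length b \<le> length w \<and> blank lb
      \<and> blank rb \<and>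
     runs (y_machine s) 2 (Start, [], map Some w) (Scan, map Some (rev
         (map mark a)) @ lb, map Some b @ rb)"
proof (cases "w \<noteq> [] \<and> hd w = letter 0 (\<not> s)")
  case True
  then obtain b where w: "w = letter 0 (\<not> s) # b" by (cases w) auto
  have "runs (y_machine s) 1 (Start, [], map Some w) (Scan, [None], map Some b)"
    by (rule runs_one) (simp add: w)
  then have "runs (y_machine s) 2 (Start, [], map Some w) (Scan, [None], map Some b)"
    by (rule runs_mono) simp
  then show ?thesis
    by (intro exI[of _ "[]"] exI[of _ b] exI[of _ "[None]"] exI[of _ "[]"]) (simp add: put_y_def w)
next
  case False
  define rb where "rb = (if w = [] then [None] else [] :: nat option list)"
  have neq: "cell (map Some w) \<noteq> Some (letter 0 (\<not> s))" using False by (cases w) auto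
  have eq: "cell (map Some w) # tl (map Some w) = map Some w @ rb" by (cases w) (auto simp: rb_def)
  have 1: "runs (y_machine s) 1 (Start, [], map Some w) (left_config Put [] (map Some w @ rb))"
    using neq eq by (intro runs_one) simp
  have 2: "runs (y_machine s) 1 (left_config Put [] (map Some w @ rb)) (Scan, [Some
      (letter 0 s)], map Some w @ rb)"
    by (rule runs_one) simp
  have "mark (letter 0 s) = letter 0 s" "\<not> xblock (letter 0 s)" by (auto simp: mark_def xblock_def)
  then show ?thesis
    using runs_trans[OF 1 2] False
    by (intro exI[of _ "[letter 0 s]"] exI[of _ w] exI[of _ "[]"] exI[of _ rb])
        (auto simp: put_y_def rb_def numeral_2_eq_2)
qed

lemma length_put_y: "length (put_y s w) \<le> length w + 1"
  by (auto simp: put_y_def)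

lemma put_y_lists: "w \<in> lists {..<6} \<Longrightarrow> put_y s w \<in> lists {..<6}"
  by (cases w) (auto simp: put_y_def letter_less)

lemma filter_put_y: "filter xblock (put_y s w) = filter xblock w"
  by (cases w) (auto simp: put_y_def xblock_def)

lemma times_y_lists: "w \<in> lists {..<6} \<Longrightarrow> times_y s w \<in> lists {..<6}"
  unfolding times_y_def by (intro pushes_lists put_y_lists)

lemma y_machine_run:
  assumes "w \<in> lists {..<6}"
  shows "\<exists>q ls rs as bs. runs (y_machine s) (12 * (length w + 1)\<^sup>2) (Start, [], map Some w)
      (q, ls, rs) \<and>
    y_machine s q (cell rs) = None \<and> rev ls @ rs = as @ map Some (times_y s w) @ bs \<and> blank as
        \<and> blank bs"
proof -
  let ?M = "y_machine s" and ?n = "length w" and ?v = "times_y s w"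
  obtain a b lb rb where a: "a @ b = put_y s w" "filter xblock a = []" "length b \<le> ?n" "blank lb"
      "blank rb"
    and 1: "runs ?M 2 (Start, [], map Some w) (Scan, map Some (rev
        (map mark a)) @ lb, map Some b @ rb)"
    using put_y_run[of s w] by blast
  have ab: "a \<in> lists {..<6}" "b \<in> lists {..<6}"
    using put_y_lists[OF assms, of s] unfolding a(1)[symmetric] by auto
  have "filter xblock (a @ b) = filter xblock w" unfolding a(1) by (rule filter_put_y)
  then have fil: "filter xblock b = filter xblock w" using a(2) by simp
  obtain rb' where rb': "blank rb'" and 2: "runs ?M ((length (filter xblock w) + 1) * (3 * ?n + 5))
      (Scan, map Some (rev (map mark a)) @ lb, map Some b @ rb) (Scan, map Some (rev
          (map mark ?v)) @ lb, rb')"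
    using scan_loop[OF ab a(5,3), of s lb] unfolding fil a(1) times_y_def by blast
  have 3: "runs ?M 1 (Scan, map Some (rev (map mark ?v)) @ lb, rb') (left_config Restore (map Some
      (rev (map mark ?v)) @ lb) (None # tl rb'))"
    by (rule runs_one) (use blank_cell_tl[OF rb'] in simp)
  have 4: "runs ?M (length (map mark ?v)) (left_config Restore (map Some (rev (map mark ?v)) @ lb)
      (None # tl rb'))
      (left_config Restore lb (map Some (map unmark (map mark ?v)) @ None # tl rb'))"
    by (rule sweep_left) simp
  have "map unmark (map mark ?v) = ?v"
    using times_y_lists[OF assms, of s] by (auto intro!: map_idI simp: unmark_mark)
  note chain = runs_trans[OF runs_trans[OF runs_trans[OF 1 2] 3] 4[unfolded this]]
  have "length ?v \<le> length (put_y s w) + length (filter xblock w)"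
    unfolding times_y_def by (rule length_pushes)
  also have "\<dots> \<le> 2 * ?n + 1"
    using length_filter_le[of xblock w] length_put_y[of s w] by linarith
  finally have "length ?v \<le> 2 * ?n + 1" .
  moreover have "(length (filter xblock w) + 1) * (3 * ?n + 5) \<le> (?n + 1) * (3 * ?n + 5)"
    using length_filter_le[of xblock w] by (intro mult_le_mono1) simp
  ultimately have "2 + (length (filter xblock w) + 1) * (3 * ?n + 5) + 1 + length (map mark ?v)
      \<le> 12 * (?n + 1)\<^sup>2"
    by (simp add: power2_eq_square algebra_simps)
  from runs_mono[OF chain this]
  have "runs ?M (12 * (?n + 1)\<^sup>2) (Start, [], map Some w) (left_config Restore lb
      (map Some ?v @ None # tl rb'))" .
  moreover have "?M Restore (cell (cell lb # map Some ?v @ None # tl rb')) = None"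
    using blank_cell_tl[OF a(4)] by simp
  moreover have "rev (tl lb) @ cell lb # map Some ?v @ None # tl rb' = (rev
      (tl lb) @ [None]) @ map Some ?v @ None # tl rb'"
    using blank_cell_tl[OF a(4)] by simp
  moreover have "blank (rev (tl lb) @ [None])" "blank (None # tl rb')"
    using blank_cell_tl[OF a(4)] blank_cell_tl[OF rb'] by auto
  ultimately show ?thesis by blast
qed

lemma polytime_times_y: "polytime_computable {..<6} (times_y s)"
proof (rule polytime_computableI[where \<delta> = "y_machine s" and \<Gamma> = "{..<8}" and s = Start and b = 12])
  show "finite (UNIV :: y_state set)" by (rule finite_y_state)
  show "times_y s \<in> lists {..<6} \<rightarrow> lists {..<6}" using times_y_lists by blast
  have small: "letter b t < 8" if "b < 3" for b t using that letter_less[of b t] by simp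
  show "y \<in> insert None (Some ` {..<8})"
    if "y_machine s q x = Some (q', y, d)" "x \<in> insert None (Some ` {..<8})" for q x q' y d
    using that by (cases q) (auto split: if_splits option.splits simp: small mark_def unmark_def
        xblock_iff)
qed (erule y_machine_run | force)+

lemma put_y_power_word:
  assumes "u = [] \<or> hd u div 2 \<noteq> 0"
  shows "put_y s (power_word 0 j @ u) = power_word 0 (j + sgn_of s) @ u"
proof (cases "0 \<le> sgn_of s * j")
  case True
  have no: "\<not> (power_word 0 j @ u \<noteq> [] \<and> hd (power_word 0 j @ u) = letter 0 (\<not> s))"
    using assms power_word_hd_last(1)[OF True, of 0] by (cases "j = 0") (auto simp: hd_append)
  show ?thesis
    unfolding put_y_def if_not_P[OF no] using power_word_step(1)[OF True, of 0] by simp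
next
  case False
  then show ?thesis using power_word_cancel(1)[OF False, of 0] by (simp add: put_y_def)
qed

lemma push_z_power_word:
  assumes "u = [] \<or> last u div 2 \<noteq> 2"
  shows "push_z d (u @ power_word 2 k) = u @ power_word 2 (k + sgn_of d)"
proof (cases "0 \<le> sgn_of d * k")
  case True
  have no: "\<not> (u @ power_word 2 k \<noteq> [] \<and> last (u @ power_word 2 k) = letter 2 (\<not> d))"
    using assms power_word_hd_last(2)[OF True, of 2] by (cases "k = 0") (auto simp: last_append)
  show ?thesis
    unfolding push_z_def if_not_P[OF no] using power_word_step(2)[OF True, of 2] by simp
next
  case False
  then show ?thesis using power_word_cancel(2)[OF False, of 2] by
      (simp add: push_z_def butlast_append)
qed

lemma times_y_normal_word: "times_y s (normal_word i j k) = normal_word i (j + sgn_of s)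
    (k + i * sgn_of s)"
proof -
  let ?u = "power_word 0 (j + sgn_of s) @ power_word 1 i"
  have "filter xblock (power_word 0 j) = []" "filter xblock (power_word 2 k) = []"
    by (auto simp: filter_empty_conv xblock_def power_word_def)
  moreover have "filter xblock (power_word 1 i) = power_word 1 i"
    by (rule filter_True) (auto simp: power_word_def xblock_def)
  ultimately have fil: "filter xblock (normal_word i j k) = power_word 1 i"
    by (simp add: normal_word_def)
  have "power_word 1 i @ power_word 2 k = [] \<or> hd (power_word 1 i @ power_word 2 k) div 2 \<noteq> 0"
    by (cases "i = 0"; cases "k = 0") (auto simp: power_word_def hd_append)
  then have put: "put_y s (normal_word i j k) = ?u @ power_word 2 k"
    unfolding normal_word_def using put_y_power_word by simp
  have last: "?u = [] \<or> last ?u div 2 \<noteq> 2"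
    by (auto simp: power_word_def last_append)
  have "pushes s (replicate m (letter 1 t)) (?u @ power_word 2 k')
      = ?u @ power_word 2 (k' + int m * sgn_of (s = t))" for m t k'
  proof (induction m arbitrary: k')
    case (Suc m)
    then show ?case
      using push_z_power_word[OF last, of "s = t" k'] by (cases t) (simp_all add: algebra_simps)
  qed simp
  from this[of "nat \<bar>i\<bar>" "i \<ge> 0" k]
  have "pushes s (power_word 1 i) (?u @ power_word 2 k) = ?u @ power_word 2 (k + i * sgn_of s)"
    unfolding power_word_def[of 1 i] by (auto simp: sgn_of_def split: if_splits)
  then show ?thesis unfolding times_y_def fil put by (simp add: normal_word_def)
qed

section \<open>Normal forms at distance zero\<close>

lemma reg_cayley_polytime_rep_heisenberg:
  "reg_cayley_polytime_rep heisenberg heisenberg_gens {..<6} normal_words spelled"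
proof -
  define f where "f = (\<lambda>g. if xco g = 0 then times_y (yco g = 1) else times_x (xco g = 1))"
  have f: "f (xgen 1) = times_x True" "f (xgen (-1)) = times_x False"
    "f (ygen 1) = times_y True" "f (ygen (-1)) = times_y False"
    by (simp_all add: f_def coordinates_gen)
  have x: "times_x s w \<in> normal_words \<and> spelled (times_x s w) = spelled w \<otimes>\<^bsub>heisenberg\<^esub> xgen
      (sgn_of s)"
    and y: "times_y s w \<in> normal_words \<and> spelled (times_y s w) = spelled w \<otimes>\<^bsub>heisenberg\<^esub> ygen
        (sgn_of s)"
    if w_in: "w \<in> normal_words" for s w
  proof -
    obtain i j k where w: "w = normal_word i j k" using w_in by (auto simp: normal_words_def)
    show "times_x s w \<in> normal_words \<and> spelled (times_x s w) = spelled w \<otimes>\<^bsub>heisenberg\<^esub> xgen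
        (sgn_of s)"
      "times_y s w \<in> normal_words \<and> spelled (times_y s w) = spelled w \<otimes>\<^bsub>heisenberg\<^esub> ygen (sgn_of s)"
      unfolding w times_x_normal_word times_y_normal_word spelled_normal_word
      by (simp_all add: normal_word_in xgen_def ygen_def)
  qed
  show ?thesis
    unfolding reg_cayley_polytime_rep_def
  proof (intro conjI exI[of _ f] ballI)
    fix s
    assume "s \<in> symmetrized heisenberg heisenberg_gens"
    then have s: "s = xgen 1 \<or> s = ygen 1 \<or> s = xgen (-1) \<or> s = ygen (-1)"
      by (simp add: symmetrized_heisenberg_gens)
    then show "polytime_computable {..<6} (f s)"
      using polytime_times_x polytime_times_y by (auto simp: f)
    show "f s ` normal_words \<subseteq> normal_words"
      using s x y by (auto simp: f)
    show "spelled (f s w) = spelled w \<otimes>\<^bsub>heisenberg\<^esub> s" if "w \<in> normal_words" for w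
      using s x[OF that, of True] x[OF that, of False] y[OF that, of True] y[OF that, of False]
      by (auto simp: f sgn_of_def)
  qed (use regular_normal_words bij_betw_spelled in simp_all)
qed

lemma (in group) cayley_distance_vanishes_if_spelled:
  assumes "L \<noteq> {}" "\<And>w. w \<in> L \<Longrightarrow> word_value G (map \<alpha> w) = \<psi> w \<and> \<psi> w \<in> carrier G"
  shows "cayley_distance_vanishes G A L \<psi> \<alpha>"
  unfolding cayley_distance_vanishes_def
proof (intro allI impI)
  fix n
  assume n: "cayley_distance_start L \<le> n"
  have "\<exists>n. {w \<in> L. length w \<le> n} \<noteq> {}" using assms(1) by auto
  then have "{w \<in> L. length w \<le> cayley_distance_start L} \<noteq> {}"
    unfolding cayley_distance_start_def by (rule LeastI_ex)
  then obtain w where "w \<in> L" "length w \<le> n" using n by auto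
  moreover have zero: "word_dist G A (word_value G (map \<alpha> w)) (\<psi> w) = 0" if "w \<in> L" for w
    using assms(2)[OF that] word_dist_self[of "\<psi> w" A] by simp
  ultimately have "{word_dist G A (word_value G (map \<alpha> w)) (\<psi> w) | w. w \<in> L \<and> length w \<le> n} = {0}"
    by force
  then show "cayley_distance G A L \<psi> \<alpha> n = 0" by (simp add: cayley_distance_def)
qed

lemma cayley_distance_vanishes_heisenberg:
  "cayley_distance_vanishes heisenberg heisenberg_gens normal_words spelled letter_elem"
  by (rule heisenberg.cayley_distance_vanishes_if_spelled) (auto simp: normal_words_def spelled_def)

theorem theorem15:
  "\<exists>(G :: nat monoid) A.
     group G \<and> finite_generating_set G A \<and>
     cayley_automatic G A \<and> separated_from_automatic G A \<and>
     (\<exists>\<Sigma> L \<psi> \<alpha>.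
        reg_cayley_polytime_rep G A \<Sigma> L \<psi> \<and> \<alpha> \<in> \<Sigma> \<rightarrow> carrier G \<and>
        cayley_distance_vanishes G A L \<psi> \<alpha>)"
proof (rule exI[of _ heisenberg], rule exI[of _ heisenberg_gens], intro conjI)
  show "\<exists>\<Sigma> L \<psi> \<alpha>. reg_cayley_polytime_rep heisenberg heisenberg_gens \<Sigma> L \<psi> \<and>
      \<alpha> \<in> \<Sigma> \<rightarrow> carrier heisenberg \<and> cayley_distance_vanishes heisenberg heisenberg_gens L \<psi> \<alpha>"
    using reg_cayley_polytime_rep_heisenberg cayley_distance_vanishes_heisenberg
    by (intro exI[of _ "{..<6}"] exI[of _ normal_words] exI[of _ spelled] exI[of _ letter_elem])
        simp
qed (rule group_heisenberg finite_generating_set_heisenberg cayley_automatic_heisenberg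
    separated_heisenberg)+

end
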